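(* Let $\mathbb{E}$ be a Gumm category. (1) On any pointed object $(X,e)$, $e:1\to X$, in $\mathbb{E}$ there is at most one internal unitary magma structure with unit $e$, and it is necessarily associative, left cancellable and commutative. (2) Any pointed morphism $f: (X,e)\to (X',e')$ between objects endowed with such unitary magma structures is a monoid homomorphism. (3) Any internal category $X_{\bullet}$ in $\mathbb{E}$ necessarily has its monoids of endomorphisms left cancellable and commutative.
   Context: A Gumm category is a finitely complete category satisfying the Shifting Lemma: for any equivalence relations $R,S,T$ on an object $X$ with $R\cap S\subset T$ and any generalized elements $x,y,x',y'$ of $X$ with $xSy$, $x'Sy'$, $xRx'$, $yRy'$, if $xTx'$ then $yTy'$. An internal unitary magma on $X$ with unit $e:1\to X$ is a morphism $m:X\times X\to X$ with $m(e,x)=x=m(x,e)$; it is left cancellable when $m(x,y)=m(x,y')$ implies $y=y'$ (for generalized elements). A pointed morphism $f$ is one with $fe=e'$. For an internal category $X_\bullet$ with object of objects $X_0$, object of morphisms $X_1$ and domain/codomain maps $d_0,d_1$, the monoids of endomorphisms are given by the pullback of $(d_0,d_1):X_1\to X_0\times X_0$ along the diagonal $X_0\to X_0\times X_0$, which, with composition and identities, is an internal monoid in the slice category $\mathbb{E}/X_0$; (3) asserts that this monoid is commutative and left cancellable. *)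

theory Defs
  imports Main
begin

section \<open>Categories and finite limits\<close>

record ('o, 'a) cat =
  Ob :: "'o set"
  Ar :: "'a set"
  Dom :: "'a \<Rightarrow> 'o"
  Cod :: "'a \<Rightarrow> 'o"
  Idn :: "'o \<Rightarrow> 'a"
  Cmp :: "'a \<Rightarrow> 'a \<Rightarrow> 'a" (infixl "\<cdot>\<index>" 70)

definition hom :: "('o, 'a) cat \<Rightarrow> 'o \<Rightarrow> 'o \<Rightarrow> 'a set" where
  "hom C A B = {f \<in> Ar C. Dom C f = A \<and> Cod C f = B}"

definition category :: "('o, 'a) cat \<Rightarrow> bool" where
  "category C \<longleftrightarrow>
     (\<forall>f\<in>Ar C. Dom C f \<in> Ob C \<and> Cod C f \<in> Ob C) \<and>
     (\<forall>A\<in>Ob C. Idn C A \<in> hom C A A) \<and>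
     (\<forall>f\<in>Ar C. \<forall>g\<in>Ar C. Dom C g = Cod C f \<longrightarrow> g \<cdot>\<^bsub>C\<^esub> f \<in> hom C (Dom C f) (Cod C g)) \<and>
     (\<forall>f\<in>Ar C. f \<cdot>\<^bsub>C\<^esub> Idn C (Dom C f) = f \<and> Idn C (Cod C f) \<cdot>\<^bsub>C\<^esub> f = f) \<and>
     (\<forall>f\<in>Ar C. \<forall>g\<in>Ar C. \<forall>h\<in>Ar C. Dom C g = Cod C f \<longrightarrow> Dom C h = Cod C g \<longrightarrow>
        h \<cdot>\<^bsub>C\<^esub> (g \<cdot>\<^bsub>C\<^esub> f) = (h \<cdot>\<^bsub>C\<^esub> g) \<cdot>\<^bsub>C\<^esub> f)"

definition is_functor ::
  "('i, 'b) cat \<Rightarrow> ('o, 'a) cat \<Rightarrow> ('i \<Rightarrow> 'o) \<Rightarrow> ('b \<Rightarrow> 'a) \<Rightarrow> bool" where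
  "is_functor J C F0 F1 \<longleftrightarrow>
     (\<forall>i\<in>Ob J. F0 i \<in> Ob C) \<and>
     (\<forall>u\<in>Ar J. F1 u \<in> hom C (F0 (Dom J u)) (F0 (Cod J u))) \<and>
     (\<forall>i\<in>Ob J. F1 (Idn J i) = Idn C (F0 i)) \<and>
     (\<forall>u\<in>Ar J. \<forall>v\<in>Ar J. Dom J v = Cod J u \<longrightarrow> F1 (v \<cdot>\<^bsub>J\<^esub> u) = F1 v \<cdot>\<^bsub>C\<^esub> F1 u)"

definition is_cone ::
  "('i, 'b) cat \<Rightarrow> ('o, 'a) cat \<Rightarrow> ('i \<Rightarrow> 'o) \<Rightarrow> ('b \<Rightarrow> 'a) \<Rightarrow> 'o \<Rightarrow> ('i \<Rightarrow> 'a) \<Rightarrow> bool" where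
  "is_cone J C F0 F1 L p \<longleftrightarrow>
     L \<in> Ob C \<and> (\<forall>i\<in>Ob J. p i \<in> hom C L (F0 i)) \<and>
     (\<forall>u\<in>Ar J. F1 u \<cdot>\<^bsub>C\<^esub> p (Dom J u) = p (Cod J u))"

definition is_limit ::
  "('i, 'b) cat \<Rightarrow> ('o, 'a) cat \<Rightarrow> ('i \<Rightarrow> 'o) \<Rightarrow> ('b \<Rightarrow> 'a) \<Rightarrow> 'o \<Rightarrow> ('i \<Rightarrow> 'a) \<Rightarrow> bool" where
  "is_limit J C F0 F1 L p \<longleftrightarrow>
     is_cone J C F0 F1 L p \<and>
     (\<forall>T t. is_cone J C F0 F1 T t \<longrightarrow>
        (\<exists>!h. h \<in> hom C T L \<and> (\<forall>i\<in>Ob J. p i \<cdot>\<^bsub>C\<^esub> h = t i)))"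

text \<open>Every finite category is isomorphic to one whose objects and arrows are natural
  numbers, so it suffices to let the shapes range over those.\<close>

definition finitely_complete :: "('o, 'a) cat \<Rightarrow> bool" where
  "finitely_complete C \<longleftrightarrow> category C \<and>
     (\<forall>(J :: (nat, nat) cat) F0 F1.
        category J \<and> finite (Ob J) \<and> finite (Ar J) \<and> is_functor J C F0 F1 \<longrightarrow>
        (\<exists>L p. is_limit J C F0 F1 L p))"

text \<open>No limits are chosen: a terminal object, a product or a pullback is given by the
  object or by its two projections (the apex being their common domain), and the notions
  below take these as arguments.\<close>

definition is_terminal :: "('o, 'a) cat \<Rightarrow> 'o \<Rightarrow> bool" where
  "is_terminal C I \<longleftrightarrow> I \<in> Ob C \<and> (\<forall>T\<in>Ob C. \<exists>!t. t \<in> hom C T I)"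

definition bang :: "('o, 'a) cat \<Rightarrow> 'o \<Rightarrow> 'o \<Rightarrow> 'a" where
  "bang C I T = (THE t. t \<in> hom C T I)"

definition is_product :: "('o, 'a) cat \<Rightarrow> 'o \<Rightarrow> 'o \<Rightarrow> 'a \<Rightarrow> 'a \<Rightarrow> bool" where
  "is_product C A B p q \<longleftrightarrow>
     A \<in> Ob C \<and> B \<in> Ob C \<and> p \<in> hom C (Dom C p) A \<and> q \<in> hom C (Dom C p) B \<and>
     (\<forall>T\<in>Ob C. \<forall>x\<in>hom C T A. \<forall>y\<in>hom C T B.
        \<exists>!h. h \<in> hom C T (Dom C p) \<and> p \<cdot>\<^bsub>C\<^esub> h = x \<and> q \<cdot>\<^bsub>C\<^esub> h = y)"

definition is_pullback :: "('o, 'a) cat \<Rightarrow> 'a \<Rightarrow> 'a \<Rightarrow> 'a \<Rightarrow> 'a \<Rightarrow> bool" where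
  "is_pullback C f g p q \<longleftrightarrow>
     f \<in> Ar C \<and> g \<in> Ar C \<and> Cod C f = Cod C g \<and>
     p \<in> hom C (Dom C p) (Dom C f) \<and> q \<in> hom C (Dom C p) (Dom C g) \<and>
     f \<cdot>\<^bsub>C\<^esub> p = g \<cdot>\<^bsub>C\<^esub> q \<and>
     (\<forall>T\<in>Ob C. \<forall>x\<in>hom C T (Dom C f). \<forall>y\<in>hom C T (Dom C g). f \<cdot>\<^bsub>C\<^esub> x = g \<cdot>\<^bsub>C\<^esub> y \<longrightarrow>
        (\<exists>!h. h \<in> hom C T (Dom C p) \<and> p \<cdot>\<^bsub>C\<^esub> h = x \<and> q \<cdot>\<^bsub>C\<^esub> h = y))"

text \<open>The arrow \<open>(x, y)\<close> into a product or a pullback with projections \<open>p\<close>, \<open>q\<close>.\<close>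

definition pair :: "('o, 'a) cat \<Rightarrow> 'a \<Rightarrow> 'a \<Rightarrow> 'a \<Rightarrow> 'a \<Rightarrow> 'a" where
  "pair C p q x y =
     (THE h. h \<in> hom C (Dom C x) (Dom C p) \<and> p \<cdot>\<^bsub>C\<^esub> h = x \<and> q \<cdot>\<^bsub>C\<^esub> h = y)"


section \<open>Gumm categories\<close>

text \<open>A relation on \<open>X\<close>, i.e. a subobject of \<open>X \<times> X\<close>, is represented by its two
  jointly monic legs.\<close>

definition relation_on :: "('o, 'a) cat \<Rightarrow> 'o \<Rightarrow> 'a \<times> 'a \<Rightarrow> bool" where
  "relation_on C X R \<longleftrightarrow>
     fst R \<in> hom C (Dom C (fst R)) X \<and> snd R \<in> hom C (Dom C (fst R)) X \<and>
     (\<forall>T\<in>Ob C. \<forall>h\<in>hom C T (Dom C (fst R)). \<forall>k\<in>hom C T (Dom C (fst R)).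
        fst R \<cdot>\<^bsub>C\<^esub> h = fst R \<cdot>\<^bsub>C\<^esub> k \<and> snd R \<cdot>\<^bsub>C\<^esub> h = snd R \<cdot>\<^bsub>C\<^esub> k \<longrightarrow> h = k)"

text \<open>The relation that \<open>R\<close> induces on the generalized elements \<open>A \<rightarrow> X\<close>:
  \<open>x R y\<close> means that \<open>(x, y)\<close> factors through \<open>R\<close>.\<close>

definition gen_rel :: "('o, 'a) cat \<Rightarrow> 'o \<Rightarrow> 'a \<times> 'a \<Rightarrow> 'o \<Rightarrow> ('a \<times> 'a) set" where
  "gen_rel C X R A = {(x, y). x \<in> hom C A X \<and> y \<in> hom C A X \<and>
     (\<exists>h\<in>hom C A (Dom C (fst R)). fst R \<cdot>\<^bsub>C\<^esub> h = x \<and> snd R \<cdot>\<^bsub>C\<^esub> h = y)}"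

definition equivalence_relation_on :: "('o, 'a) cat \<Rightarrow> 'o \<Rightarrow> 'a \<times> 'a \<Rightarrow> bool" where
  "equivalence_relation_on C X R \<longleftrightarrow>
     relation_on C X R \<and> (\<forall>A\<in>Ob C. equiv (hom C A X) (gen_rel C X R A))"

definition shifting_lemma :: "('o, 'a) cat \<Rightarrow> bool" where
  "shifting_lemma C \<longleftrightarrow>
     (\<forall>X\<in>Ob C. \<forall>R S T.
        equivalence_relation_on C X R \<and> equivalence_relation_on C X S \<and>
        equivalence_relation_on C X T \<and>
        (\<forall>A\<in>Ob C. gen_rel C X R A \<inter> gen_rel C X S A \<subseteq> gen_rel C X T A) \<longrightarrow>
        (\<forall>A\<in>Ob C. \<forall>x\<in>hom C A X. \<forall>y\<in>hom C A X. \<forall>x'\<in>hom C A X. \<forall>y'\<in>hom C A X.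
           (x, y) \<in> gen_rel C X S A \<and> (x', y') \<in> gen_rel C X S A \<and>
           (x, x') \<in> gen_rel C X R A \<and> (y, y') \<in> gen_rel C X R A \<and>
           (x, x') \<in> gen_rel C X T A \<longrightarrow> (y, y') \<in> gen_rel C X T A))"

definition gumm_category :: "('o, 'a) cat \<Rightarrow> bool" where
  "gumm_category C \<longleftrightarrow> finitely_complete C \<and> shifting_lemma C"


section \<open>Internal unitary magmas and monoids\<close>

text \<open>In this section \<open>I\<close> is a terminal object and \<open>p\<close>, \<open>q\<close> are the projections of a
  product of \<open>X\<close> with itself.\<close>

definition pointed_object :: "('o, 'a) cat \<Rightarrow> 'o \<Rightarrow> 'o \<Rightarrow> 'a \<Rightarrow> bool" where
  "pointed_object C I X e \<longleftrightarrow> is_terminal C I \<and> X \<in> Ob C \<and> e \<in> hom C I X"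

definition mul :: "('o, 'a) cat \<Rightarrow> 'a \<Rightarrow> 'a \<Rightarrow> 'a \<Rightarrow> 'a \<Rightarrow> 'a \<Rightarrow> 'a" where
  "mul C p q m x y = m \<cdot>\<^bsub>C\<^esub> pair C p q x y"

definition unitary_magma ::
  "('o, 'a) cat \<Rightarrow> 'o \<Rightarrow> 'o \<Rightarrow> 'a \<Rightarrow> 'a \<Rightarrow> 'a \<Rightarrow> 'a \<Rightarrow> bool" where
  "unitary_magma C I X e p q m \<longleftrightarrow>
     pointed_object C I X e \<and> is_product C X X p q \<and> m \<in> hom C (Dom C p) X \<and>
     (\<forall>T\<in>Ob C. \<forall>x\<in>hom C T X.
        mul C p q m (e \<cdot>\<^bsub>C\<^esub> bang C I T) x = x \<and> mul C p q m x (e \<cdot>\<^bsub>C\<^esub> bang C I T) = x)"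

definition magma_associative :: "('o, 'a) cat \<Rightarrow> 'o \<Rightarrow> 'a \<Rightarrow> 'a \<Rightarrow> 'a \<Rightarrow> bool" where
  "magma_associative C X p q m \<longleftrightarrow>
     (\<forall>T\<in>Ob C. \<forall>x\<in>hom C T X. \<forall>y\<in>hom C T X. \<forall>z\<in>hom C T X.
        mul C p q m (mul C p q m x y) z = mul C p q m x (mul C p q m y z))"

definition magma_commutative :: "('o, 'a) cat \<Rightarrow> 'o \<Rightarrow> 'a \<Rightarrow> 'a \<Rightarrow> 'a \<Rightarrow> bool" where
  "magma_commutative C X p q m \<longleftrightarrow>
     (\<forall>T\<in>Ob C. \<forall>x\<in>hom C T X. \<forall>y\<in>hom C T X. mul C p q m x y = mul C p q m y x)"

definition left_cancellable :: "('o, 'a) cat \<Rightarrow> 'o \<Rightarrow> 'a \<Rightarrow> 'a \<Rightarrow> 'a \<Rightarrow> bool" where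
  "left_cancellable C X p q m \<longleftrightarrow>
     (\<forall>T\<in>Ob C. \<forall>x\<in>hom C T X. \<forall>y\<in>hom C T X. \<forall>y'\<in>hom C T X.
        mul C p q m x y = mul C p q m x y' \<longrightarrow> y = y')"

definition internal_monoid ::
  "('o, 'a) cat \<Rightarrow> 'o \<Rightarrow> 'o \<Rightarrow> 'a \<Rightarrow> 'a \<Rightarrow> 'a \<Rightarrow> 'a \<Rightarrow> bool" where
  "internal_monoid C I X e p q m \<longleftrightarrow>
     unitary_magma C I X e p q m \<and> magma_associative C X p q m"

definition pointed_morphism ::
  "('o, 'a) cat \<Rightarrow> 'o \<Rightarrow> 'a \<Rightarrow> 'o \<Rightarrow> 'a \<Rightarrow> 'a \<Rightarrow> bool" where
  "pointed_morphism C X e X' e' f \<longleftrightarrow> f \<in> hom C X X' \<and> f \<cdot>\<^bsub>C\<^esub> e = e'"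

definition monoid_hom ::
  "('o, 'a) cat \<Rightarrow> 'o \<Rightarrow> 'o \<Rightarrow> 'a \<Rightarrow> 'a \<Rightarrow> 'a \<Rightarrow> 'a \<Rightarrow> 'o \<Rightarrow> 'a \<Rightarrow> 'a \<Rightarrow> 'a \<Rightarrow> 'a \<Rightarrow> 'a \<Rightarrow> bool"
  where
  "monoid_hom C I X e p q m X' e' p' q' m' f \<longleftrightarrow>
     internal_monoid C I X e p q m \<and> internal_monoid C I X' e' p' q' m' \<and>
     pointed_morphism C X e X' e' f \<and>
     f \<cdot>\<^bsub>C\<^esub> m = m' \<cdot>\<^bsub>C\<^esub> pair C p' q' (f \<cdot>\<^bsub>C\<^esub> p) (f \<cdot>\<^bsub>C\<^esub> q)"


section \<open>Slice categories\<close>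

text \<open>An arrow \<open>a\<close> from \<open>f\<close> to \<open>g\<close> over \<open>B\<close> is represented by the triple \<open>(f, a, g)\<close>.\<close>

definition slice :: "('o, 'a) cat \<Rightarrow> 'o \<Rightarrow> ('a, 'a \<times> 'a \<times> 'a) cat" where
  "slice C B = \<lparr>
     Ob = {f \<in> Ar C. Cod C f = B},
     Ar = {(f, a, g). f \<in> Ar C \<and> Cod C f = B \<and> g \<in> Ar C \<and> Cod C g = B \<and>
             a \<in> hom C (Dom C f) (Dom C g) \<and> g \<cdot>\<^bsub>C\<^esub> a = f},
     Dom = (\<lambda>(f, a, g). f),
     Cod = (\<lambda>(f, a, g). g),
     Idn = (\<lambda>f. (f, Idn C (Dom C f), f)),
     Cmp = (\<lambda>(f', b, h) (f, a, g). (f, b \<cdot>\<^bsub>C\<^esub> a, h)) \<rparr>"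

definition underlying :: "'a \<times> 'a \<times> 'a \<Rightarrow> 'a" where
  "underlying = (\<lambda>(f, a, g). a)"


section \<open>Internal categories and their endomorphism monoids\<close>

text \<open>\<open>pr1\<close>, \<open>pr2\<close> are the projections of the object of composable pairs \<open>(x, y)\<close>, where
  \<open>d0 x = d1 y\<close>; \<open>cmp\<close> maps such a pair to the composite ``\<open>x\<close> after \<open>y\<close>''.\<close>

record ('o, 'a) internal_cat =
  X0 :: 'o
  X1 :: 'o
  d0 :: 'a
  d1 :: 'a
  s0 :: 'a
  pr1 :: 'a
  pr2 :: 'a
  cmp :: 'a

definition icomp :: "('o, 'a) cat \<Rightarrow> ('o, 'a) internal_cat \<Rightarrow> 'a \<Rightarrow> 'a \<Rightarrow> 'a" where
  "icomp C G x y = cmp G \<cdot>\<^bsub>C\<^esub> pair C (pr1 G) (pr2 G) x y"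

definition internal_category :: "('o, 'a) cat \<Rightarrow> ('o, 'a) internal_cat \<Rightarrow> bool" where
  "internal_category C G \<longleftrightarrow>
     X0 G \<in> Ob C \<and> X1 G \<in> Ob C \<and>
     d0 G \<in> hom C (X1 G) (X0 G) \<and> d1 G \<in> hom C (X1 G) (X0 G) \<and> s0 G \<in> hom C (X0 G) (X1 G) \<and>
     d0 G \<cdot>\<^bsub>C\<^esub> s0 G = Idn C (X0 G) \<and> d1 G \<cdot>\<^bsub>C\<^esub> s0 G = Idn C (X0 G) \<and>
     is_pullback C (d0 G) (d1 G) (pr1 G) (pr2 G) \<and>
     cmp G \<in> hom C (Dom C (pr1 G)) (X1 G) \<and>
     d0 G \<cdot>\<^bsub>C\<^esub> cmp G = d0 G \<cdot>\<^bsub>C\<^esub> pr2 G \<and> d1 G \<cdot>\<^bsub>C\<^esub> cmp G = d1 G \<cdot>\<^bsub>C\<^esub> pr1 G \<and>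
     (\<forall>T\<in>Ob C. \<forall>x\<in>hom C T (X1 G).
        icomp C G x (s0 G \<cdot>\<^bsub>C\<^esub> (d0 G \<cdot>\<^bsub>C\<^esub> x)) = x \<and>
        icomp C G (s0 G \<cdot>\<^bsub>C\<^esub> (d1 G \<cdot>\<^bsub>C\<^esub> x)) x = x) \<and>
     (\<forall>T\<in>Ob C. \<forall>x\<in>hom C T (X1 G). \<forall>y\<in>hom C T (X1 G). \<forall>z\<in>hom C T (X1 G).
        d0 G \<cdot>\<^bsub>C\<^esub> x = d1 G \<cdot>\<^bsub>C\<^esub> y \<and> d0 G \<cdot>\<^bsub>C\<^esub> y = d1 G \<cdot>\<^bsub>C\<^esub> z \<longrightarrow>
        icomp C G (icomp C G x y) z = icomp C G x (icomp C G y z))"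

text \<open>\<open>j : E \<rightarrow> X1\<close> and \<open>k : E \<rightarrow> X0\<close> form a pullback of \<open>(d0, d1) : X1 \<rightarrow> X0 \<times> X0\<close> along the
  diagonal, where \<open>u\<close>, \<open>v\<close> are the projections of \<open>X0 \<times> X0\<close>.\<close>

definition endomorphism_object ::
  "('o, 'a) cat \<Rightarrow> ('o, 'a) internal_cat \<Rightarrow> 'a \<Rightarrow> 'a \<Rightarrow> 'a \<Rightarrow> 'a \<Rightarrow> bool" where
  "endomorphism_object C G u v j k \<longleftrightarrow>
     is_product C (X0 G) (X0 G) u v \<and>
     is_pullback C (pair C u v (d0 G) (d1 G)) (pair C u v (Idn C (X0 G)) (Idn C (X0 G))) j k"

text \<open>The arrows of the slice over \<open>X0\<close> that identities and composition induce on the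
  object \<open>k : E \<rightarrow> X0\<close>. The terminal object of the slice is the identity of \<open>X0\<close>, and
  \<open>P\<close>, \<open>Q\<close> are the projections of a product of \<open>k\<close> with itself in the slice.\<close>

definition endo_unit ::
  "('o, 'a) cat \<Rightarrow> ('o, 'a) internal_cat \<Rightarrow> 'a \<Rightarrow> 'a \<Rightarrow> 'a \<times> 'a \<times> 'a" where
  "endo_unit C G j k = (Idn C (X0 G), pair C j k (s0 G) (Idn C (X0 G)), k)"

definition endo_mult ::
  "('o, 'a) cat \<Rightarrow> ('o, 'a) internal_cat \<Rightarrow> 'a \<Rightarrow> 'a \<Rightarrow> 'a \<times> 'a \<times> 'a \<Rightarrow> 'a \<times> 'a \<times> 'a
     \<Rightarrow> 'a \<times> 'a \<times> 'a" where
  "endo_mult C G j k P Q =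
     (let w = Dom (slice C (X0 G)) P in
      (w, pair C j k (icomp C G (j \<cdot>\<^bsub>C\<^esub> underlying P) (j \<cdot>\<^bsub>C\<^esub> underlying Q)) w, k))"

end

theory Submission
  imports Defs
begin

text \<open>The Shifting Lemma is only applied to kernel pairs of maps out of powers of \<open>X\<close>. Shifting
  \<open>(x, y)\<close>, \<open>(x, y')\<close> along the second projection to \<open>(e, y)\<close>, \<open>(e, y')\<close>, inside the kernel pair of
  the first one, shows that \<open>xy = xy'\<close> implies \<open>y = y'\<close>. By symmetry \<open>m\<close> is right cancellable, so the
  kernel pairs of \<open>m\<close> and of the second projection meet trivially, and the Shifting Lemma applies to
  them and the kernel pair of any \<open>h : X \<times> X \<rightarrow> Z\<close>: if \<open>h(e, y) = h(y, e)\<close> then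
  \<open>h(x, y) = h(xy, e)\<close>. Taking \<open>h(x, y)\<close> to be \<open>yx\<close>, \<open>f(x)f(y)\<close> and, with a parameter, \<open>x(yz)\<close> yields
  commutativity, compatibility with pointed morphisms (hence uniqueness) and associativity.
  The Shifting Lemma for kernel pairs passes to slices, which gives the case of endomorphisms.\<close>

section \<open>Products and pullbacks\<close>

locale ambient_category =
  fixes C :: "('o, 'a) cat" (structure)
  assumes category: "category C"
begin

lemma hom_Ob:
  assumes "f \<in> hom C A B"
  shows "A \<in> Ob C" "B \<in> Ob C"
  using assms category by (auto simp: hom_def category_def)

lemma hom_ArD:
  assumes "f \<in> hom C A B"
  shows "f \<in> Ar C" "Dom C f = A" "Cod C f = B"
  using assms by (auto simp: hom_def)

lemma Idn_in_hom: "A \<in> Ob C \<Longrightarrow> Idn C A \<in> hom C A A"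
  using category by (simp add: category_def)

lemma comp_in_hom: "f \<in> hom C A B \<Longrightarrow> g \<in> hom C B D \<Longrightarrow> g \<cdot> f \<in> hom C A D"
  using category unfolding category_def hom_def by fastforce

lemma comp_Idn: "f \<in> hom C A B \<Longrightarrow> f \<cdot> Idn C A = f"
  using category unfolding category_def hom_def by fastforce

lemma Idn_comp: "f \<in> hom C A B \<Longrightarrow> Idn C B \<cdot> f = f"
  using category unfolding category_def hom_def by fastforce

lemma comp_assoc:
  "f \<in> hom C A B \<Longrightarrow> g \<in> hom C B D \<Longrightarrow> h \<in> hom C D E \<Longrightarrow> (h \<cdot> g) \<cdot> f = h \<cdot> (g \<cdot> f)"
  using category unfolding category_def hom_def by fastforce

section \<open>Terminal objects and binary products\<close>

lemma bang_in_hom: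
  assumes "is_terminal C I" "T \<in> Ob C"
  shows "bang C I T \<in> hom C T I"
  using assms unfolding is_terminal_def bang_def by (metis (mono_tags, lifting) theI')

lemma terminal_unique: "is_terminal C I \<Longrightarrow> f \<in> hom C T I \<Longrightarrow> g \<in> hom C T I \<Longrightarrow> f = g"
  using hom_Ob unfolding is_terminal_def by metis

lemma product_projections:
  assumes "is_product C A B p q"
  shows "p \<in> hom C (Dom C p) A" "q \<in> hom C (Dom C p) B"
  using assms by (auto simp: is_product_def)

lemma pair_props:
  assumes "is_product C A B p q" "x \<in> hom C T A" "y \<in> hom C T B"
  shows "pair C p q x y \<in> hom C T (Dom C p) \<and> p \<cdot> pair C p q x y = x \<and> q \<cdot> pair C p q x y = y"
proof -
  have "\<exists>!h. h \<in> hom C T (Dom C p) \<and> p \<cdot> h = x \<and> q \<cdot> h = y"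
    using assms hom_Ob[OF assms(2)] unfolding is_product_def by blast
  from theI'[OF this] show ?thesis
    using hom_ArD(2)[OF assms(2)] unfolding pair_def by simp
qed

lemmas pair_in_hom = pair_props[THEN conjunct1]
  and fst_pair = pair_props[THEN conjunct2, THEN conjunct1]
  and snd_pair = pair_props[THEN conjunct2, THEN conjunct2]

lemma product_eqI:
  assumes "is_product C A B p q" "h \<in> hom C T (Dom C p)" "h' \<in> hom C T (Dom C p)"
    "p \<cdot> h = p \<cdot> h'" "q \<cdot> h = q \<cdot> h'"
  shows "h = h'"
proof -
  have "p \<cdot> h \<in> hom C T A" "q \<cdot> h \<in> hom C T B"
    using assms product_projections comp_in_hom by blast+
  then have "\<exists>!k. k \<in> hom C T (Dom C p) \<and> p \<cdot> k = p \<cdot> h \<and> q \<cdot> k = q \<cdot> h"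
    using assms(1) hom_Ob[OF assms(2)] unfolding is_product_def by blast
  then show ?thesis using assms by metis
qed

text \<open>Every element of a product is the pair of its coordinates; most later computations with
  maps out of a product rest on this.\<close>

lemma pair_eqI:
  assumes "is_product C A B p q" "h \<in> hom C T (Dom C p)" "p \<cdot> h = x" "q \<cdot> h = y"
  shows "h = pair C p q x y"
proof -
  have xy: "x \<in> hom C T A" "y \<in> hom C T B"
    using assms product_projections comp_in_hom by blast+
  show ?thesis
    by (rule product_eqI[OF assms(1,2)]) (simp_all add: pair_props[OF assms(1) xy] assms(3,4))
qed

lemma pair_comp:
  assumes "is_product C A B p q" "x \<in> hom C T A" "y \<in> hom C T B" "h \<in> hom C S T"
  shows "pair C p q x y \<cdot> h = pair C p q (x \<cdot> h) (y \<cdot> h)"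
proof (rule pair_eqI[OF assms(1)])
  note xy = pair_props[OF assms(1-3)]
  show "pair C p q x y \<cdot> h \<in> hom C S (Dom C p)"
    using xy assms(4) comp_in_hom by blast
  show "p \<cdot> (pair C p q x y \<cdot> h) = x \<cdot> h" "q \<cdot> (pair C p q x y \<cdot> h) = y \<cdot> h"
    using xy comp_assoc[OF assms(4) conjunct1[OF xy] product_projections(1)[OF assms(1)]]
      comp_assoc[OF assms(4) conjunct1[OF xy] product_projections(2)[OF assms(1)]] by simp_all
qed

text \<open>The apex is read off from the first listed projection, so the exchange of factors rests
  on both projections having the same domain.\<close>

lemma product_swap:
  assumes "is_product C A B p q"
  shows "is_product C B A q p"
proof -
  have "Dom C q = Dom C p"
    using product_projections[OF assms] hom_ArD by metis
  then show ?thesis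
    using assms unfolding is_product_def by (simp add: conj_commute)
qed

lemma pair_swap:
  assumes "is_product C A B p q" "x \<in> hom C T A" "y \<in> hom C T B"
  shows "pair C q p y x = pair C p q x y"
proof -
  have "Dom C q = Dom C p" "Dom C y = Dom C x"
    using product_projections[OF assms(1)] assms hom_ArD by metis+
  then show ?thesis unfolding pair_def by (simp add: conj_commute)
qed

section \<open>Pullbacks and factorizations through them\<close>

lemma pullback_projections:
  assumes "is_pullback C f g p q" "f \<in> hom C A D" "g \<in> hom C B D"
  shows "p \<in> hom C (Dom C p) A" "q \<in> hom C (Dom C p) B" "f \<cdot> p = g \<cdot> q"
  using assms by (auto simp: is_pullback_def hom_def)

lemma pullback_ex1:
  assumes "is_pullback C f g p q" "f \<in> hom C A D" "g \<in> hom C B D"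
    "x \<in> hom C T A" "y \<in> hom C T B" "f \<cdot> x = g \<cdot> y"
  shows "\<exists>!h. h \<in> hom C T (Dom C p) \<and> p \<cdot> h = x \<and> q \<cdot> h = y"
proof -
  have "T \<in> Ob C" "Dom C f = A" "Dom C g = B"
    using assms hom_Ob hom_ArD by metis+
  then show ?thesis using assms unfolding is_pullback_def by blast
qed

lemma pullback_eqI:
  assumes "is_pullback C f g p q" "h \<in> hom C T (Dom C p)" "h' \<in> hom C T (Dom C p)"
    "p \<cdot> h = p \<cdot> h'" "q \<cdot> h = q \<cdot> h'"
  shows "h = h'"
proof -
  have fg: "f \<in> hom C (Dom C f) (Cod C f)" "g \<in> hom C (Dom C g) (Cod C f)"
    using assms(1) by (auto simp: is_pullback_def hom_def)
  note pq = pullback_projections[OF assms(1) fg]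
  have "f \<cdot> (p \<cdot> h) = g \<cdot> (q \<cdot> h)"
    using comp_assoc[OF assms(2) pq(1) fg(1)] comp_assoc[OF assms(2) pq(2) fg(2)] pq(3) by simp
  from pullback_ex1[OF assms(1) fg comp_in_hom[OF assms(2) pq(1)] comp_in_hom[OF assms(2) pq(2)] this]
  show ?thesis using assms by metis
qed

lemma pullback_pair_props:
  assumes "is_pullback C f g p q" "f \<in> hom C A D" "g \<in> hom C B D"
    "x \<in> hom C T A" "y \<in> hom C T B" "f \<cdot> x = g \<cdot> y"
  shows "pair C p q x y \<in> hom C T (Dom C p) \<and> p \<cdot> pair C p q x y = x \<and> q \<cdot> pair C p q x y = y"
  using theI'[OF pullback_ex1[OF assms]] hom_ArD(2)[OF assms(4)] unfolding pair_def by simp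

lemma pullback_pair_comp:
  assumes "is_pullback C f g p q" "f \<in> hom C A D" "g \<in> hom C B D"
    "x \<in> hom C T A" "y \<in> hom C T B" "f \<cdot> x = g \<cdot> y" "h \<in> hom C S T"
  shows "pair C p q x y \<cdot> h = pair C p q (x \<cdot> h) (y \<cdot> h)"
proof -
  note xy = pullback_pair_props[OF assms(1-6)] and pq = pullback_projections[OF assms(1-3)]
  have "f \<cdot> (x \<cdot> h) = g \<cdot> (y \<cdot> h)"
    using comp_assoc[OF assms(7,4,2)] comp_assoc[OF assms(7,5,3)] assms(6) by simp
  note xyh = pullback_pair_props[OF assms(1-3) comp_in_hom[OF assms(7,4)] comp_in_hom[OF assms(7,5)] this]
  show ?thesis
  proof (rule pullback_eqI[OF assms(1)])
    show "pair C p q x y \<cdot> h \<in> hom C S (Dom C p)" using xy assms(7) comp_in_hom by blast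
    show "pair C p q (x \<cdot> h) (y \<cdot> h) \<in> hom C S (Dom C p)" using xyh by blast
    show "p \<cdot> (pair C p q x y \<cdot> h) = p \<cdot> pair C p q (x \<cdot> h) (y \<cdot> h)"
      "q \<cdot> (pair C p q x y \<cdot> h) = q \<cdot> pair C p q (x \<cdot> h) (y \<cdot> h)"
      using xy xyh comp_assoc[OF assms(7) conjunct1[OF xy] pq(1)]
        comp_assoc[OF assms(7) conjunct1[OF xy] pq(2)] by simp_all
  qed
qed

text \<open>Over a terminal object the commutation condition on a pair of elements always holds.
  This is how the triple product for associativity is obtained from pullbacks.\<close>

lemma pullback_over_terminal_is_product:
  assumes "is_terminal C I" "is_pullback C f g p q" "f \<in> hom C A I" "g \<in> hom C B I"
  shows "is_product C A B p q"
proof -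
  have "f \<cdot> x = g \<cdot> y" if "x \<in> hom C T A" "y \<in> hom C T B" for x y T
    using that assms comp_in_hom terminal_unique by meson
  then show ?thesis
    unfolding is_product_def
    using pullback_projections[OF assms(2-4)] pullback_ex1[OF assms(2-4)]
      hom_Ob[OF assms(3)] hom_Ob[OF assms(4)] by blast
qed

end

section \<open>The Shifting Lemma for kernel pairs\<close>

text \<open>The free cospan: the arrows \<open>0\<close>, \<open>1\<close>, \<open>2\<close> are the
  identities, \<open>3\<close> goes from \<open>0\<close> to \<open>2\<close> and \<open>4\<close>
  from \<open>1\<close> to \<open>2\<close>. In every composable pair one factor is an identity, so
  \<open>Cmp\<close> only has to return the other one.\<close>

definition cospan_shape :: "(nat, nat) cat" where
  "cospan_shape = \<lparr>
     Ob = {0, 1, 2}, Ar = {0, 1, 2, 3, 4},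
     Dom = (\<lambda>a. if a < 3 then a else a - 3), Cod = (\<lambda>a. if a < 3 then a else 2),
     Idn = (\<lambda>i. i), Cmp = (\<lambda>b a. if b < 3 then a else b) \<rparr>"

lemma category_cospan_shape: "category cospan_shape"
  unfolding category_def hom_def cospan_shape_def by simp

text \<open>A cone over the cospan is determined by its components at \<open>0\<close> and
  \<open>1\<close>, since the one at \<open>2\<close> is their common image; dropping it turns the
  universal property of the limit into that of a pullback.\<close>

lemma pullback_exists:
  assumes "finitely_complete C" "f \<in> hom C A D" "g \<in> hom C B D"
  shows "\<exists>p q. is_pullback C f g p q"
proof -
  interpret ambient_category C using assms(1) by unfold_locales (simp add: finitely_complete_def)
  define F0 where "F0 = (\<lambda>i::nat. if i = 0 then A else if i = 1 then B else D)"
  define F1 where "F1 = (\<lambda>a::nat. if a < 3 then Idn C (F0 a) else if a = 3 then f else g)"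
  note Ob = hom_Ob[OF assms(2)] hom_Ob[OF assms(3)]
  have F: "is_functor cospan_shape C F0 F1"
    unfolding is_functor_def cospan_shape_def F1_def F0_def
    using assms(2,3) Ob
    by (simp add: Idn_in_hom Idn_comp[OF assms(2)] comp_Idn[OF assms(2)] Idn_comp[OF assms(3)]
      comp_Idn[OF assms(3)] Idn_comp[OF Idn_in_hom])
  have "finite (Ob cospan_shape)" "finite (Ar cospan_shape)"
    by (auto simp: cospan_shape_def)
  then obtain L l where L: "is_limit cospan_shape C F0 F1 L l"
    using F assms(1) category_cospan_shape unfolding finitely_complete_def by blast
  have cone_iff: "is_cone cospan_shape C F0 F1 T t \<longleftrightarrow>
      t 0 \<in> hom C T A \<and> t 1 \<in> hom C T B \<and> t 2 \<in> hom C T D \<and> f \<cdot>\<^bsub>C\<^esub> t 0 = t 2 \<and> g \<cdot>\<^bsub>C\<^esub> t 1 = t 2"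
    for T t
    unfolding is_cone_def cospan_shape_def F1_def F0_def
    using Idn_comp hom_Ob by auto
  have l: "l 0 \<in> hom C L A" "l 1 \<in> hom C L B" "f \<cdot>\<^bsub>C\<^esub> l 0 = g \<cdot>\<^bsub>C\<^esub> l 1" "l 2 = f \<cdot>\<^bsub>C\<^esub> l 0"
    using L unfolding is_limit_def cone_iff by auto
  have "\<exists>!h. h \<in> hom C T L \<and> l 0 \<cdot>\<^bsub>C\<^esub> h = x \<and> l 1 \<cdot>\<^bsub>C\<^esub> h = y"
    if xy: "x \<in> hom C T A" "y \<in> hom C T B" "f \<cdot>\<^bsub>C\<^esub> x = g \<cdot>\<^bsub>C\<^esub> y" for T x y
  proof -
    define t where "t = (\<lambda>i::nat. if i = 0 then x else if i = 1 then y else f \<cdot>\<^bsub>C\<^esub> x)"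
    have "is_cone cospan_shape C F0 F1 T t"
      unfolding cone_iff t_def using xy assms comp_in_hom by auto
    then have ex: "\<exists>!h. h \<in> hom C T L \<and> (\<forall>i\<in>Ob cospan_shape. l i \<cdot>\<^bsub>C\<^esub> h = t i)"
      using L unfolding is_limit_def by blast
    have "l 2 \<cdot>\<^bsub>C\<^esub> h = f \<cdot>\<^bsub>C\<^esub> (l 0 \<cdot>\<^bsub>C\<^esub> h)" if "h \<in> hom C T L" for h
      using comp_assoc[OF that l(1) assms(2)] l(4) by simp
    then have "(h \<in> hom C T L \<and> (\<forall>i\<in>Ob cospan_shape. l i \<cdot>\<^bsub>C\<^esub> h = t i)) \<longleftrightarrow>
        (h \<in> hom C T L \<and> l 0 \<cdot>\<^bsub>C\<^esub> h = x \<and> l 1 \<cdot>\<^bsub>C\<^esub> h = y)" for h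
      unfolding cospan_shape_def t_def by auto
    then show ?thesis using ex by simp
  qed
  then have "is_pullback C f g (l 0) (l 1)"
    unfolding is_pullback_def using l assms(2,3) hom_ArD by simp
  then show ?thesis by blast
qed

text \<open>The Shifting Lemma for the kernel pairs of \<open>r\<close>, \<open>s\<close>,
  \<open>t\<close>, written with equations between generalized elements instead of subobjects. In
  this form it mentions no limits and can be carried over to a slice directly. The stage
  \<open>T\<close> may range over everything, because in a category \<open>hom C T Y\<close> is
  empty unless \<open>T\<close> is an object.\<close>

definition kernel_shifting :: "('o, 'a) cat \<Rightarrow> bool" where
  "kernel_shifting C \<longleftrightarrow>
     (\<forall>Y A B D r s t.
        r \<in> hom C Y A \<and> s \<in> hom C Y B \<and> t \<in> hom C Y D \<and>
        (\<forall>T. \<forall>a\<in>hom C T Y. \<forall>b\<in>hom C T Y.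
           r \<cdot>\<^bsub>C\<^esub> a = r \<cdot>\<^bsub>C\<^esub> b \<and> s \<cdot>\<^bsub>C\<^esub> a = s \<cdot>\<^bsub>C\<^esub> b \<longrightarrow> t \<cdot>\<^bsub>C\<^esub> a = t \<cdot>\<^bsub>C\<^esub> b) \<longrightarrow>
        (\<forall>T. \<forall>a\<in>hom C T Y. \<forall>b\<in>hom C T Y. \<forall>a'\<in>hom C T Y. \<forall>b'\<in>hom C T Y.
           s \<cdot>\<^bsub>C\<^esub> a = s \<cdot>\<^bsub>C\<^esub> b \<and> s \<cdot>\<^bsub>C\<^esub> a' = s \<cdot>\<^bsub>C\<^esub> b' \<and>
           r \<cdot>\<^bsub>C\<^esub> a = r \<cdot>\<^bsub>C\<^esub> a' \<and> r \<cdot>\<^bsub>C\<^esub> b = r \<cdot>\<^bsub>C\<^esub> b' \<and> t \<cdot>\<^bsub>C\<^esub> a = t \<cdot>\<^bsub>C\<^esub> a' \<longrightarrow>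
           t \<cdot>\<^bsub>C\<^esub> b = t \<cdot>\<^bsub>C\<^esub> b'))"

text \<open>The dictionary between kernel pairs as subobjects and equations: factoring through the
  pullback means having the same image under \<open>f\<close>.\<close>

lemma (in ambient_category) kernel_pair_gen_rel:
  assumes "is_pullback C f f p q" "f \<in> hom C Y A"
  shows "gen_rel C Y (p, q) T = {(x, y). x \<in> hom C T Y \<and> y \<in> hom C T Y \<and> f \<cdot> x = f \<cdot> y}"
proof -
  note pq = pullback_projections[OF assms(1,2,2)]
  have "f \<cdot> (p \<cdot> h) = f \<cdot> (q \<cdot> h)" if "h \<in> hom C T (Dom C p)" for h
    using comp_assoc[OF that pq(1) assms(2)] comp_assoc[OF that pq(2) assms(2)] pq(3) by simp
  moreover have "\<exists>h\<in>hom C T (Dom C p). p \<cdot> h = x \<and> q \<cdot> h = y"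
    if "x \<in> hom C T Y" "y \<in> hom C T Y" "f \<cdot> x = f \<cdot> y" for x y
    using pullback_ex1[OF assms(1,2,2) that] by blast
  ultimately show ?thesis
    unfolding gen_rel_def fst_conv snd_conv by blast
qed

text \<open>On generalized elements the relation is equality of images, and the legs are jointly
  monic by the uniqueness part of the pullback property.\<close>

lemma (in ambient_category) kernel_pair_equivalence_relation:
  assumes "is_pullback C f f p q" "f \<in> hom C Y A"
  shows "equivalence_relation_on C Y (p, q)"
  unfolding equivalence_relation_on_def
proof
  show "relation_on C Y (p, q)"
    unfolding relation_on_def fst_conv snd_conv
    using pullback_projections[OF assms(1,2,2)] pullback_eqI[OF assms(1)] by blast
  show "\<forall>T\<in>Ob C. equiv (hom C T Y) (gen_rel C Y (p, q) T)"
    unfolding kernel_pair_gen_rel[OF assms]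
    by (auto simp: equiv_def refl_on_def sym_def trans_def)
qed

text \<open>Finite completeness provides the three kernel pairs, to which the Shifting Lemma is
  applied; \<open>kernel_pair_gen_rel\<close> translates back.\<close>

lemma gumm_category_kernel_shifting:
  assumes "gumm_category C"
  shows "kernel_shifting C"
  unfolding kernel_shifting_def
proof (intro allI impI ballI; elim conjE)
  fix Y A B D r s t T a b a' b'
  assume r: "r \<in> hom C Y A" and s: "s \<in> hom C Y B" and t: "t \<in> hom C Y D"
    and le: "\<forall>T. \<forall>a\<in>hom C T Y. \<forall>b\<in>hom C T Y.
           r \<cdot>\<^bsub>C\<^esub> a = r \<cdot>\<^bsub>C\<^esub> b \<and> s \<cdot>\<^bsub>C\<^esub> a = s \<cdot>\<^bsub>C\<^esub> b \<longrightarrow> t \<cdot>\<^bsub>C\<^esub> a = t \<cdot>\<^bsub>C\<^esub> b"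
    and ab: "a \<in> hom C T Y" "b \<in> hom C T Y" "a' \<in> hom C T Y" "b' \<in> hom C T Y"
    and eqs: "s \<cdot>\<^bsub>C\<^esub> a = s \<cdot>\<^bsub>C\<^esub> b" "s \<cdot>\<^bsub>C\<^esub> a' = s \<cdot>\<^bsub>C\<^esub> b'" "r \<cdot>\<^bsub>C\<^esub> a = r \<cdot>\<^bsub>C\<^esub> a'"
      "r \<cdot>\<^bsub>C\<^esub> b = r \<cdot>\<^bsub>C\<^esub> b'" "t \<cdot>\<^bsub>C\<^esub> a = t \<cdot>\<^bsub>C\<^esub> a'"
  have fc: "finitely_complete C" and sl: "shifting_lemma C"
    using assms by (auto simp: gumm_category_def)
  interpret ambient_category C using fc by unfold_locales (simp add: finitely_complete_def)
  obtain r1 r2 s1 s2 t1 t2 where pb: "is_pullback C r r r1 r2" "is_pullback C s s s1 s2"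
    "is_pullback C t t t1 t2"
    using pullback_exists[OF fc r r] pullback_exists[OF fc s s] pullback_exists[OF fc t t] by blast
  note R = kernel_pair_gen_rel[OF pb(1) r] and S = kernel_pair_gen_rel[OF pb(2) s]
    and T = kernel_pair_gen_rel[OF pb(3) t]
  have Y: "Y \<in> Ob C" "T \<in> Ob C" using hom_Ob ab by metis+
  have "\<forall>A\<in>Ob C. gen_rel C Y (r1, r2) A \<inter> gen_rel C Y (s1, s2) A \<subseteq> gen_rel C Y (t1, t2) A"
    unfolding R S T using le by auto
  note rels = kernel_pair_equivalence_relation[OF pb(1) r] kernel_pair_equivalence_relation[OF pb(2) s]
    kernel_pair_equivalence_relation[OF pb(3) t] this
  have rect: "(a, b) \<in> gen_rel C Y (s1, s2) T" "(a', b') \<in> gen_rel C Y (s1, s2) T"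
    "(a, a') \<in> gen_rel C Y (r1, r2) T" "(b, b') \<in> gen_rel C Y (r1, r2) T"
    "(a, a') \<in> gen_rel C Y (t1, t2) T"
    unfolding R S T using ab eqs by simp_all
  have "(b, b') \<in> gen_rel C Y (t1, t2) T"
    using sl[unfolded shifting_lemma_def, rule_format, OF Y(1) _ Y(2) ab(1,2,3,4),
        of "(r1, r2)" "(s1, s2)" "(t1, t2)"] rels rect by blast
  then show "t \<cdot>\<^bsub>C\<^esub> b = t \<cdot>\<^bsub>C\<^esub> b'"
    unfolding T by simp
qed

section \<open>Unitary magmas\<close>

locale kernel_shifting_category = ambient_category +
  assumes kernel_shifting: "kernel_shifting C"
begin

text \<open>Rule form for a rectangle with sides \<open>a\<close>, \<open>b\<close> and
  \<open>a'\<close>, \<open>b'\<close> in the kernel pair of \<open>s\<close> and sides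
  \<open>a\<close>, \<open>a'\<close> and \<open>b\<close>, \<open>b'\<close> in that of
  \<open>r\<close>.\<close>

lemma kernel_shift:
  assumes "r \<in> hom C Y A" "s \<in> hom C Y B" "t \<in> hom C Y D"
    and "\<And>T a b. a \<in> hom C T Y \<Longrightarrow> b \<in> hom C T Y \<Longrightarrow> r \<cdot> a = r \<cdot> b \<Longrightarrow> s \<cdot> a = s \<cdot> b \<Longrightarrow>
      t \<cdot> a = t \<cdot> b"
    and "a \<in> hom C T Y" "b \<in> hom C T Y" "a' \<in> hom C T Y" "b' \<in> hom C T Y"
    and "s \<cdot> a = s \<cdot> b" "s \<cdot> a' = s \<cdot> b'" "r \<cdot> a = r \<cdot> a'" "r \<cdot> b = r \<cdot> b'" "t \<cdot> a = t \<cdot> a'"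
  shows "t \<cdot> b = t \<cdot> b'"
proof -
  have "\<forall>T. \<forall>a\<in>hom C T Y. \<forall>b\<in>hom C T Y. r \<cdot> a = r \<cdot> b \<and> s \<cdot> a = s \<cdot> b \<longrightarrow> t \<cdot> a = t \<cdot> b"
    using assms(4) by blast
  then show ?thesis
    using kernel_shifting[unfolded kernel_shifting_def, rule_format, OF _ assms(5-8),
        where r = r and s = s and t = t and A = A and B = B and D = D] assms(1-3,9-)
    by blast
qed

end

text \<open>Of the ambient category only \<open>kernel_shifting\<close> is assumed, so that the
  results can be instantiated in a slice; associativity takes finite completeness as an explicit
  hypothesis.\<close>

locale magma_in_category = kernel_shifting_category C
  for C :: "('o, 'a) cat" (structure) +
  fixes I X e p q m
  assumes unitary: "unitary_magma C I X e p q m"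
begin

abbreviation mult (infixl "\<star>" 75) where "x \<star> y \<equiv> mul C p q m x y"
abbreviation unit where "unit T \<equiv> e \<cdot> bang C I T"
abbreviation pr where "pr x y \<equiv> pair C p q x y"

lemma terminal: "is_terminal C I"
  and X_Ob: "X \<in> Ob C"
  and e_in_hom: "e \<in> hom C I X"
  and square: "is_product C X X p q"
  and m_in_hom: "m \<in> hom C (Dom C p) X"
  using unitary by (auto simp: unitary_magma_def pointed_object_def)

lemmas p_in_hom = product_projections(1)[OF square]
  and q_in_hom = product_projections(2)[OF square]
  and pr_in_hom = pair_in_hom[OF square]
  and p_pr = fst_pair[OF square]
  and q_pr = snd_pair[OF square]

section \<open>Multiplication of generalized elements\<close>

lemma mult_in_hom: "x \<in> hom C T X \<Longrightarrow> y \<in> hom C T X \<Longrightarrow> x \<star> y \<in> hom C T X"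
  unfolding mul_def using pr_in_hom m_in_hom comp_in_hom by blast

lemma unit_in_hom: "T \<in> Ob C \<Longrightarrow> unit T \<in> hom C T X"
  using bang_in_hom[OF terminal] e_in_hom comp_in_hom by blast

lemma unit_mult: "x \<in> hom C T X \<Longrightarrow> unit T \<star> x = x"
  and mult_unit: "x \<in> hom C T X \<Longrightarrow> x \<star> unit T = x"
  using unitary hom_Ob by (auto simp: unitary_magma_def)

lemma mult_comp:
  assumes "x \<in> hom C T X" "y \<in> hom C T X" "h \<in> hom C S T"
  shows "(x \<star> y) \<cdot> h = (x \<cdot> h) \<star> (y \<cdot> h)"
  unfolding mul_def
  using comp_assoc[OF assms(3) pr_in_hom[OF assms(1,2)] m_in_hom] pair_comp[OF square assms] by simp

lemma m_comp:
  assumes "h \<in> hom C T (Dom C p)"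
  shows "m \<cdot> h = (p \<cdot> h) \<star> (q \<cdot> h)"
  unfolding mul_def using pair_eqI[OF square assms] by simp

text \<open>The projections are jointly monic, so their kernel pairs meet in equality and hence
  inside the kernel pair of \<open>m\<close>. Shifting then replaces the left factor
  \<open>x\<close> by the unit.\<close>

lemma mult_left_cancel:
  assumes "x \<in> hom C T X" "y \<in> hom C T X" "y' \<in> hom C T X" "x \<star> y = x \<star> y'"
  shows "y = y'"
proof -
  have u: "unit T \<in> hom C T X" using unit_in_hom hom_Ob assms by metis
  have "m \<cdot> pr (unit T) y = m \<cdot> pr (unit T) y'"
  proof (rule kernel_shift[OF p_in_hom q_in_hom m_in_hom])
    show "m \<cdot> pr x y = m \<cdot> pr x y'" using assms(4) by (simp add: mul_def)
    show "m \<cdot> a = m \<cdot> b" if "a \<in> hom C T (Dom C p)" "b \<in> hom C T (Dom C p)"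
      "p \<cdot> a = p \<cdot> b" "q \<cdot> a = q \<cdot> b" for T a b
      using product_eqI[OF square that] by simp
  qed (use assms u in \<open>auto simp: p_pr[where T=T] q_pr[where T=T] intro!: pr_in_hom\<close>)
  then show ?thesis using unit_mult assms by (simp add: mul_def)
qed

text \<open>Exchanging the projections while keeping the arrow \<open>m\<close> gives the opposite
  multiplication, so each result on left factors has a mirror image.\<close>

lemma opposite_unitary: "unitary_magma C I X e q p m"
proof -
  have "Dom C q = Dom C p" using q_in_hom hom_ArD by metis
  then have "m \<in> hom C (Dom C q) X" using m_in_hom by simp
  moreover have "mul C q p m x y = y \<star> x" if "x \<in> hom C T X" "y \<in> hom C T X" for T x y
    unfolding mul_def using pair_swap[OF square that(2,1)] by simp
  moreover have "unit T \<in> hom C T X" if "x \<in> hom C T X" for x T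
    using unit_in_hom hom_Ob that by metis
  ultimately show ?thesis
    unfolding unitary_magma_def pointed_object_def
    using terminal X_Ob e_in_hom product_swap[OF square] unit_mult mult_unit by metis
qed

lemma mult_right_cancel:
  assumes "x \<in> hom C T X" "x' \<in> hom C T X" "y \<in> hom C T X" "x \<star> y = x' \<star> y"
  shows "x = x'"
proof -
  interpret op: magma_in_category C I X e q p m
    by unfold_locales (rule opposite_unitary)
  show ?thesis
    using op.mult_left_cancel[OF assms(3,1,2)] assms(4)
      pair_swap[OF square assms(1,3)] pair_swap[OF square assms(2,3)] by (simp add: mul_def)
qed

text \<open>In the shifted rectangle, \<open>(e, y)\<close> and \<open>(y, e)\<close> are moved along the kernel pair of the
  second projection to \<open>(x, y)\<close> and \<open>(xy, e)\<close>; both sides lie in the kernel pair of \<open>m\<close>.\<close>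

lemma map_eq_map_mult_unit:
  assumes h: "h \<in> hom C (Dom C p) Z"
    and axes: "\<And>T y. y \<in> hom C T X \<Longrightarrow> h \<cdot> pr (unit T) y = h \<cdot> pr y (unit T)"
    and x: "x \<in> hom C T X" and y: "y \<in> hom C T X"
  shows "h \<cdot> pr x y = h \<cdot> pr (x \<star> y) (unit T)"
proof (rule kernel_shift[OF m_in_hom q_in_hom h])
  have u: "unit T \<in> hom C T X" using unit_in_hom hom_Ob x by metis
  have xy: "x \<star> y \<in> hom C T X" using mult_in_hom x y by blast
  show "h \<cdot> pr (unit T) y = h \<cdot> pr y (unit T)" using axes y by blast
  show "m \<cdot> pr (unit T) y = m \<cdot> pr y (unit T)"
    using unit_mult[OF y] mult_unit[OF y] by (simp add: mul_def)
  show "m \<cdot> pr x y = m \<cdot> pr (x \<star> y) (unit T)"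
    using mult_unit[OF xy] by (simp add: mul_def)
  show "pr (unit T) y \<in> hom C T (Dom C p)" "pr x y \<in> hom C T (Dom C p)"
    "pr y (unit T) \<in> hom C T (Dom C p)" "pr (x \<star> y) (unit T) \<in> hom C T (Dom C p)"
    using pr_in_hom u x y xy by blast+
  show "q \<cdot> pr (unit T) y = q \<cdot> pr x y" "q \<cdot> pr y (unit T) = q \<cdot> pr (x \<star> y) (unit T)"
    using q_pr u x y xy by simp_all
  \<comment> \<open>Right cancellation makes \<open>m\<close> and \<open>q\<close> jointly monic:
    product and second coordinate determine the first coordinate.\<close>
  show "h \<cdot> a = h \<cdot> b" if "a \<in> hom C T (Dom C p)" "b \<in> hom C T (Dom C p)"
    "m \<cdot> a = m \<cdot> b" "q \<cdot> a = q \<cdot> b" for T a b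
  proof -
    have "(p \<cdot> a) \<star> (q \<cdot> b) = (p \<cdot> b) \<star> (q \<cdot> b)" using that m_comp by simp
    then have "p \<cdot> a = p \<cdot> b"
      using mult_right_cancel that p_in_hom q_in_hom comp_in_hom by meson
    then show ?thesis using product_eqI[OF square] that by blast
  qed
qed

text \<open>The map \<open>h\<close> sends \<open>(x, y)\<close> to \<open>yx\<close> and agrees on
  the two axes, so its value at \<open>(x, y)\<close> equals its value at \<open>(xy, e)\<close>,
  which is \<open>xy\<close>.\<close>

lemma mult_commute:
  assumes "x \<in> hom C T X" "y \<in> hom C T X"
  shows "x \<star> y = y \<star> x"
proof -
  define h where "h = q \<star> p"
  have h: "h \<in> hom C (Dom C p) X" using mult_in_hom p_in_hom q_in_hom by (simp add: h_def)
  have h_pr: "h \<cdot> pr x y = y \<star> x" if "x \<in> hom C T X" "y \<in> hom C T X" for x y T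
    using mult_comp[OF q_in_hom p_in_hom pr_in_hom[OF that]] p_pr[OF that] q_pr[OF that]
    by (simp add: h_def)
  have u: "unit S \<in> hom C S X" if "y \<in> hom C S X" for S y using that unit_in_hom hom_Ob by metis
  have xy: "x \<star> y \<in> hom C T X" using mult_in_hom[OF assms] .
  have "h \<cdot> pr x y = h \<cdot> pr (x \<star> y) (unit T)"
  proof (rule map_eq_map_mult_unit[OF h _ assms])
    fix S z assume z: "z \<in> hom C S X"
    show "h \<cdot> pr (unit S) z = h \<cdot> pr z (unit S)"
      unfolding h_pr[OF z u[OF z]] h_pr[OF u[OF z] z] unit_mult[OF z] mult_unit[OF z] ..
  qed
  then show ?thesis
    unfolding h_pr[OF assms] h_pr[OF xy u[OF xy]] unit_mult[OF xy] by simp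
qed

text \<open>The projections form the generic pair of elements; evaluating there turns identities
  between elements into equations between arrows.\<close>

lemma mult_projections: "p \<star> q = m"
proof -
  have Y: "Dom C p \<in> Ob C" using hom_Ob[OF p_in_hom] by blast
  from m_comp[OF Idn_in_hom[OF Y]] show ?thesis
    by (simp add: comp_Idn[OF p_in_hom] comp_Idn[OF q_in_hom] comp_Idn[OF m_in_hom])
qed

text \<open>The map \<open>h\<close> sends \<open>(x, y)\<close> to \<open>f(x)f(y)\<close>. On both
  axes it is \<open>f\<close>, because \<open>f\<close> preserves the unit, and at
  \<open>(xy, e)\<close> its value is \<open>f(xy)\<close>.\<close>

lemma pointed_morphism_mult:
  assumes other: "unitary_magma C I X' e' p' q' m'"
    and f: "pointed_morphism C X e X' e' f"
    and x: "x \<in> hom C T X" and y: "y \<in> hom C T X"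
  shows "f \<cdot> (x \<star> y) = mul C p' q' m' (f \<cdot> x) (f \<cdot> y)"
proof -
  interpret o': magma_in_category C I X' e' p' q' m'
    by unfold_locales (rule other)
  have f_hom: "f \<in> hom C X X'" and fe: "f \<cdot> e = e'"
    using f by (auto simp: pointed_morphism_def)
  define h where "h = o'.mult (f \<cdot> p) (f \<cdot> q)"
  have fpq: "f \<cdot> p \<in> hom C (Dom C p) X'" "f \<cdot> q \<in> hom C (Dom C p) X'"
    using comp_in_hom f_hom p_in_hom q_in_hom by blast+
  then have h: "h \<in> hom C (Dom C p) X'" unfolding h_def by (rule o'.mult_in_hom)
  have h_pr: "h \<cdot> pr x y = o'.mult (f \<cdot> x) (f \<cdot> y)" if "x \<in> hom C T X" "y \<in> hom C T X" for x y T
    unfolding h_def o'.mult_comp[OF fpq pr_in_hom[OF that]]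
      comp_assoc[OF pr_in_hom[OF that] p_in_hom f_hom] comp_assoc[OF pr_in_hom[OF that] q_in_hom f_hom]
      p_pr[OF that] q_pr[OF that] ..
  have u: "unit S \<in> hom C S X" if "z \<in> hom C S X" for S z using that unit_in_hom hom_Ob by metis
  have fu: "f \<cdot> unit S = o'.unit S" if "z \<in> hom C S X" for S z
    using comp_assoc[OF bang_in_hom[OF terminal] e_in_hom f_hom] fe hom_Ob[OF that] by simp
  have f_comp: "f \<cdot> z \<in> hom C S X'" if "z \<in> hom C S X" for S z
    using comp_in_hom f_hom that by blast
  have xy: "x \<star> y \<in> hom C T X" using mult_in_hom[OF x y] .
  have "h \<cdot> pr x y = h \<cdot> pr (x \<star> y) (unit T)"
  proof (rule map_eq_map_mult_unit[OF h _ x y])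
    fix S z assume z: "z \<in> hom C S X"
    show "h \<cdot> pr (unit S) z = h \<cdot> pr z (unit S)"
      unfolding h_pr[OF z u[OF z]] h_pr[OF u[OF z] z] fu[OF z]
        o'.unit_mult[OF f_comp[OF z]] o'.mult_unit[OF f_comp[OF z]] ..
  qed
  then show ?thesis
    unfolding h_pr[OF x y] h_pr[OF xy u[OF xy]] fu[OF xy] o'.mult_unit[OF f_comp[OF xy]] by simp
qed

text \<open>The identity of \<open>X\<close> is a pointed morphism between the two structures, hence
  compatible with their multiplications; evaluating at the projections identifies \<open>m\<close>
  and \<open>m'\<close>.\<close>

lemma unitary_magma_unique:
  assumes "unitary_magma C I X e p q m'"
  shows "m' = m"
proof -
  have other: "magma_in_category C I X e p q m'"
    using kernel_shifting_category_axioms assms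
    by (simp add: magma_in_category_def magma_in_category_axioms_def)
  have "pointed_morphism C X e X e (Idn C X)"
    unfolding pointed_morphism_def using Idn_in_hom[OF X_Ob] Idn_comp[OF e_in_hom] by (rule conjI)
  from pointed_morphism_mult[OF assms this p_in_hom q_in_hom] show ?thesis
    by (simp add: Idn_comp[OF p_in_hom] Idn_comp[OF q_in_hom] Idn_comp[OF m_in_hom]
      mult_projections magma_in_category.mult_projections[OF other])
qed

text \<open>The argument of \<open>map_eq_map_mult_unit\<close> with a parameter \<open>z\<close>: the rectangle is
  \<open>(e, y, z)\<close>, \<open>(y, e, z)\<close>, \<open>(x, y, z)\<close>, \<open>(xy, e, z)\<close>, and the map is \<open>x(yz)\<close>.\<close>

lemma mult_assoc:
  assumes fc: "finitely_complete C"
    and x: "x \<in> hom C T X" and y: "y \<in> hom C T X" and z: "z \<in> hom C T X"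
  shows "(x \<star> y) \<star> z = x \<star> (y \<star> z)"
proof -
  let ?Y = "Dom C p"
  have Y: "?Y \<in> Ob C" using hom_Ob[OF p_in_hom] by blast
  \<comment> \<open>The triple product is formed as the product of \<open>X\<close> with itself,
    times \<open>X\<close>; \<open>a\<close>, \<open>b\<close>, \<open>d\<close> below are its three
    coordinates.\<close>
  obtain c d where "is_pullback C (bang C I ?Y) (bang C I X) c d"
    using pullback_exists[OF fc bang_in_hom[OF terminal Y] bang_in_hom[OF terminal X_Ob]] by blast
  then have cube: "is_product C ?Y X c d"
    using pullback_over_terminal_is_product[OF terminal] bang_in_hom[OF terminal] Y X_Ob by blast
  let ?W = "Dom C c"
  note c = product_projections(1)[OF cube] and d = product_projections(2)[OF cube]
  define a b where "a = p \<cdot> c" and "b = q \<cdot> c"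
  have a: "a \<in> hom C ?W X" and b: "b \<in> hom C ?W X"
    unfolding a_def b_def using comp_in_hom c p_in_hom q_in_hom by blast+
  \<comment> \<open>On triples, \<open>r\<close> is \<open>(xy, z)\<close> and \<open>s\<close> is
    \<open>(y, z)\<close>: these are \<open>m\<close> and the second projection with the parameter
    \<open>z\<close> carried along.\<close>
  define r s t where "r = pr (a \<star> b) d" and "s = pr b d" and "t = a \<star> (b \<star> d)"
  have r: "r \<in> hom C ?W ?Y" and s: "s \<in> hom C ?W ?Y" and t: "t \<in> hom C ?W X"
    unfolding r_def s_def t_def
    using pr_in_hom[OF mult_in_hom[OF a b] d] pr_in_hom[OF b d] mult_in_hom[OF a mult_in_hom[OF b d]]
    by simp_all
  have r_comp: "r \<cdot> h = pr ((a \<cdot> h) \<star> (b \<cdot> h)) (d \<cdot> h)"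
    and s_comp: "s \<cdot> h = pr (b \<cdot> h) (d \<cdot> h)"
    and t_comp: "t \<cdot> h = (a \<cdot> h) \<star> ((b \<cdot> h) \<star> (d \<cdot> h))"
    if h: "h \<in> hom C S ?W" for S h
    unfolding r_def s_def t_def
    using pair_comp[OF square mult_in_hom[OF a b] d h] pair_comp[OF square b d h]
      mult_comp[OF a b h] mult_comp[OF b d h] mult_comp[OF a mult_in_hom[OF b d] h] by simp_all
  define tr where "tr x y z = pair C c d (pr x y) z" for x y z
  have tr: "tr x y z \<in> hom C T ?W" and a_tr: "a \<cdot> tr x y z = x" and b_tr: "b \<cdot> tr x y z = y"
    and d_tr: "d \<cdot> tr x y z = z"
    if "x \<in> hom C T X" "y \<in> hom C T X" "z \<in> hom C T X" for x y z
  proof -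
    note xy = pr_in_hom[OF that(1,2)]
    note props = pair_props[OF cube xy that(3)]
    show tr: "tr x y z \<in> hom C T ?W" and "d \<cdot> tr x y z = z" using props by (simp_all add: tr_def)
    show "a \<cdot> tr x y z = x" "b \<cdot> tr x y z = y"
      unfolding a_def b_def comp_assoc[OF tr c p_in_hom] comp_assoc[OF tr c q_in_hom]
      using props p_pr[OF that(1,2)] q_pr[OF that(1,2)] by (simp_all add: tr_def)
  qed
  \<comment> \<open>The maps \<open>r\<close> and \<open>s\<close> are jointly monic:
    \<open>s\<close> gives \<open>y\<close> and \<open>z\<close>, and then \<open>r\<close> gives
    \<open>x\<close> by right cancellation.\<close>
  have inj: "h = h'" if h: "h \<in> hom C S ?W" and h': "h' \<in> hom C S ?W"
    and rr: "r \<cdot> h = r \<cdot> h'" and ss: "s \<cdot> h = s \<cdot> h'" for S h h'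
  proof -
    note elts = comp_in_hom[OF h a] comp_in_hom[OF h b] comp_in_hom[OF h d]
      and elts' = comp_in_hom[OF h' a] comp_in_hom[OF h' b] comp_in_hom[OF h' d]
    have dd: "d \<cdot> h = d \<cdot> h'"
      using arg_cong[OF ss, of "\<lambda>f. q \<cdot> f"] unfolding s_comp[OF h] s_comp[OF h']
      by (simp add: q_pr[OF elts(2,3)] q_pr[OF elts'(2,3)])
    have bb: "b \<cdot> h = b \<cdot> h'"
      using arg_cong[OF ss, of "\<lambda>f. p \<cdot> f"] unfolding s_comp[OF h] s_comp[OF h']
      by (simp add: p_pr[OF elts(2,3)] p_pr[OF elts'(2,3)])
    have "(a \<cdot> h) \<star> (b \<cdot> h) = (a \<cdot> h') \<star> (b \<cdot> h')"
      using arg_cong[OF rr, of "\<lambda>f. p \<cdot> f"] unfolding r_comp[OF h] r_comp[OF h']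
      by (simp add: p_pr[OF mult_in_hom[OF elts(1,2)] elts(3)]
        p_pr[OF mult_in_hom[OF elts'(1,2)] elts'(3)])
    then have aa: "a \<cdot> h = a \<cdot> h'"
      using mult_right_cancel[OF elts(1) elts'(1) elts(2)] bb by simp
    have "c \<cdot> h = c \<cdot> h'"
      using product_eqI[OF square comp_in_hom[OF h c] comp_in_hom[OF h' c]] aa bb
      unfolding a_def b_def
      by (simp add: comp_assoc[OF h c p_in_hom] comp_assoc[OF h' c p_in_hom]
        comp_assoc[OF h c q_in_hom] comp_assoc[OF h' c q_in_hom])
    then show "h = h'" using product_eqI[OF cube h h'] dd by blast
  qed
  have u: "unit T \<in> hom C T X" using unit_in_hom hom_Ob x by metis
  have xy: "x \<star> y \<in> hom C T X" using mult_in_hom[OF x y] .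
  note e1 = u y z and e2 = y u z and e3 = x y z and e4 = xy u z
  \<comment> \<open>On the given side of the rectangle both values of \<open>t\<close> are
    \<open>yz\<close>; on the shifted side they are \<open>x(yz)\<close> and
    \<open>(xy)z\<close>.\<close>
  have "t \<cdot> tr x y z = t \<cdot> tr (x \<star> y) (unit T) z"
  proof (rule kernel_shift[OF r s t _ tr[OF e1] tr[OF e3] tr[OF e2] tr[OF e4]])
    show "t \<cdot> h = t \<cdot> h'" if "h \<in> hom C S ?W" "h' \<in> hom C S ?W" "r \<cdot> h = r \<cdot> h'" "s \<cdot> h = s \<cdot> h'"
      for S h h' using inj[OF that] by simp
  qed (simp_all add: s_comp[OF tr[OF e1]] s_comp[OF tr[OF e2]] s_comp[OF tr[OF e3]]
      s_comp[OF tr[OF e4]] r_comp[OF tr[OF e1]] r_comp[OF tr[OF e2]] r_comp[OF tr[OF e3]]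
      r_comp[OF tr[OF e4]] t_comp[OF tr[OF e1]] t_comp[OF tr[OF e2]]
      a_tr[OF e1] a_tr[OF e2] a_tr[OF e3] a_tr[OF e4] b_tr[OF e1] b_tr[OF e2] b_tr[OF e3] b_tr[OF e4]
      d_tr[OF e1] d_tr[OF e2] d_tr[OF e3] d_tr[OF e4] unit_mult[OF y] mult_unit[OF y] mult_unit[OF xy]
      unit_mult[OF z] unit_mult[OF mult_in_hom[OF y z]])
  then show ?thesis
    by (simp add: t_comp[OF tr[OF e3]] t_comp[OF tr[OF e4]] a_tr[OF e3] a_tr[OF e4]
      b_tr[OF e3] b_tr[OF e4] d_tr[OF e3] d_tr[OF e4] unit_mult[OF z])
qed

lemma magma_left_cancellable: "left_cancellable C X p q m"
  unfolding left_cancellable_def using mult_left_cancel by blast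

lemma magma_commutative: "magma_commutative C X p q m"
  unfolding magma_commutative_def using mult_commute by blast

lemma magma_associative: "finitely_complete C \<Longrightarrow> magma_associative C X p q m"
  unfolding magma_associative_def using mult_assoc by blast

end

section \<open>Slices\<close>

lemma slice_hom_iff:
  "x \<in> hom (slice C B) f g \<longleftrightarrow>
     (\<exists>a. x = (f, a, g) \<and> f \<in> hom C (Dom C f) B \<and> g \<in> hom C (Dom C g) B \<and>
       a \<in> hom C (Dom C f) (Dom C g) \<and> g \<cdot>\<^bsub>C\<^esub> a = f)"
  by (auto simp: slice_def hom_def)

lemma slice_hom_cases:
  assumes "x \<in> hom (slice C B) f g"
  obtains a where "x = (f, a, g)" "f \<in> hom C (Dom C f) B" "g \<in> hom C (Dom C g) B"
    "a \<in> hom C (Dom C f) (Dom C g)" "g \<cdot>\<^bsub>C\<^esub> a = f"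
  using assms unfolding slice_hom_iff by blast

lemma slice_comp [simp]: "(f', b, h) \<cdot>\<^bsub>slice C B\<^esub> (f, a, g) = (f, b \<cdot>\<^bsub>C\<^esub> a, h)"
  by (simp add: slice_def)

lemma slice_Idn: "Idn (slice C B) f = (f, Idn C (Dom C f), f)"
  by (simp add: slice_def)

context ambient_category
begin

text \<open>The laws are inherited from the middle components; the recorded source and target of
  each triple keep composites well typed.\<close>

lemma slice_category: "category (slice C B)"
proof -
  have comp: "y \<cdot>\<^bsub>slice C B\<^esub> x \<in> hom (slice C B) f h"
    if x: "x \<in> hom (slice C B) f g" and y: "y \<in> hom (slice C B) g h" for x y f g h
  proof -
    obtain a where a: "x = (f, a, g)" "f \<in> hom C (Dom C f) B" "g \<in> hom C (Dom C g) B"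
      "a \<in> hom C (Dom C f) (Dom C g)" "g \<cdot> a = f" using x by (rule slice_hom_cases)
    obtain b where b: "y = (g, b, h)" "h \<in> hom C (Dom C h) B"
      "b \<in> hom C (Dom C g) (Dom C h)" "h \<cdot> b = g" using y by (rule slice_hom_cases)
    show ?thesis
      using a b comp_in_hom[OF a(4) b(3)] comp_assoc[OF a(4) b(3,2)] by (simp add: slice_hom_iff)
  qed
  have Idn: "Idn (slice C B) f \<in> hom (slice C B) f f" if "f \<in> Ob (slice C B)" for f
  proof -
    have "f \<in> hom C (Dom C f) B" using that by (simp add: slice_def hom_def)
    then show ?thesis
      using Idn_in_hom comp_Idn hom_Ob unfolding slice_hom_iff by (simp add: slice_def)
  qed
  have assoc: "z \<cdot>\<^bsub>slice C B\<^esub> (y \<cdot>\<^bsub>slice C B\<^esub> x) = (z \<cdot>\<^bsub>slice C B\<^esub> y) \<cdot>\<^bsub>slice C B\<^esub> x"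
    if x: "x \<in> hom (slice C B) f g" and y: "y \<in> hom (slice C B) g h" and z: "z \<in> hom (slice C B) h i"
    for x y z f g h i
  proof -
    obtain a b c where "x = (f, a, g)" "y = (g, b, h)" "z = (h, c, i)"
      "a \<in> hom C (Dom C f) (Dom C g)" "b \<in> hom C (Dom C g) (Dom C h)" "c \<in> hom C (Dom C h) (Dom C i)"
      using x y z unfolding slice_hom_iff by blast
    then show ?thesis using comp_assoc by simp
  qed
  have Ids: "x \<cdot>\<^bsub>slice C B\<^esub> Idn (slice C B) f = x" "Idn (slice C B) g \<cdot>\<^bsub>slice C B\<^esub> x = x"
    if "x \<in> hom (slice C B) f g" for x f g
    using that comp_Idn Idn_comp by (auto simp: slice_hom_iff slice_Idn)
  have homI: "x \<in> hom (slice C B) (Dom (slice C B) x) (Cod (slice C B) x)" if "x \<in> Ar (slice C B)" for x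
    using that by (simp add: hom_def)
  show ?thesis
    unfolding category_def
  proof (intro conjI ballI impI)
    fix x y assume "x \<in> Ar (slice C B)" "y \<in> Ar (slice C B)" "Dom (slice C B) y = Cod (slice C B) x"
    then show "y \<cdot>\<^bsub>slice C B\<^esub> x \<in> hom (slice C B) (Dom (slice C B) x) (Cod (slice C B) y)"
      using homI comp by metis
  next
    fix x y z assume "x \<in> Ar (slice C B)" "y \<in> Ar (slice C B)" "z \<in> Ar (slice C B)"
      "Dom (slice C B) y = Cod (slice C B) x" "Dom (slice C B) z = Cod (slice C B) y"
    then show "z \<cdot>\<^bsub>slice C B\<^esub> (y \<cdot>\<^bsub>slice C B\<^esub> x) = (z \<cdot>\<^bsub>slice C B\<^esub> y) \<cdot>\<^bsub>slice C B\<^esub> x"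
      using homI assoc by metis
  next
    fix x assume "x \<in> Ar (slice C B)"
    note x = homI[OF this]
    show "x \<cdot>\<^bsub>slice C B\<^esub> Idn (slice C B) (Dom (slice C B) x) = x"
      "Idn (slice C B) (Cod (slice C B) x) \<cdot>\<^bsub>slice C B\<^esub> x = x"
      using Ids[OF x] by blast+
    have Ob: "f \<in> Ob (slice C B)" if "f \<in> hom C (Dom C f) B" for f
      using hom_ArD[OF that] by (simp add: slice_def)
    show "Dom (slice C B) x \<in> Ob (slice C B)" "Cod (slice C B) x \<in> Ob (slice C B)"
      by (rule slice_hom_cases[OF x], erule Ob)+
  qed (rule Idn)
qed

text \<open>An arrow from \<open>f\<close> to the identity of \<open>B\<close> over \<open>B\<close>
  can only be \<open>f\<close> itself.\<close>

lemma slice_terminal: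
  assumes "B \<in> Ob C"
  shows "is_terminal (slice C B) (Idn C B)"
proof -
  have B: "Idn C B \<in> hom C B B" "Dom C (Idn C B) = B"
    using Idn_in_hom[OF assms] hom_ArD by blast+
  have "f \<in> hom C (Dom C f) B" if "f \<in> Ob (slice C B)" for f
    using that by (simp add: slice_def hom_def)
  then have "x \<in> hom (slice C B) f (Idn C B) \<longleftrightarrow> x = (f, f, Idn C B)" if "f \<in> Ob (slice C B)" for x f
    using that B Idn_comp unfolding slice_hom_iff by force
  moreover have "Idn C B \<in> Ob (slice C B)" using B by (simp add: slice_def hom_def)
  ultimately show ?thesis unfolding is_terminal_def by simp
qed

end

text \<open>Elements of an object over \<open>B\<close> identified by a map over \<open>B\<close> have the same image in
  \<open>B\<close>, hence the inclusion of kernel pairs needs to be tested over \<open>B\<close> only.\<close>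

lemma (in kernel_shifting_category) slice_kernel_shifting: "kernel_shifting (slice C B)"
  unfolding kernel_shifting_def
proof (intro allI impI ballI; elim conjE)
  fix Y A A' D r s t T a b a' b'
  assume r: "r \<in> hom (slice C B) Y A" and s: "s \<in> hom (slice C B) Y A'"
    and t: "t \<in> hom (slice C B) Y D"
    and le: "\<forall>T. \<forall>a\<in>hom (slice C B) T Y. \<forall>b\<in>hom (slice C B) T Y.
       r \<cdot>\<^bsub>slice C B\<^esub> a = r \<cdot>\<^bsub>slice C B\<^esub> b \<and> s \<cdot>\<^bsub>slice C B\<^esub> a = s \<cdot>\<^bsub>slice C B\<^esub> b \<longrightarrow>
       t \<cdot>\<^bsub>slice C B\<^esub> a = t \<cdot>\<^bsub>slice C B\<^esub> b"
    and ab: "a \<in> hom (slice C B) T Y" "b \<in> hom (slice C B) T Y"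
      "a' \<in> hom (slice C B) T Y" "b' \<in> hom (slice C B) T Y"
    and eqs: "s \<cdot>\<^bsub>slice C B\<^esub> a = s \<cdot>\<^bsub>slice C B\<^esub> b" "s \<cdot>\<^bsub>slice C B\<^esub> a' = s \<cdot>\<^bsub>slice C B\<^esub> b'"
      "r \<cdot>\<^bsub>slice C B\<^esub> a = r \<cdot>\<^bsub>slice C B\<^esub> a'" "r \<cdot>\<^bsub>slice C B\<^esub> b = r \<cdot>\<^bsub>slice C B\<^esub> b'"
      "t \<cdot>\<^bsub>slice C B\<^esub> a = t \<cdot>\<^bsub>slice C B\<^esub> a'"
  obtain r1 where r1: "r = (Y, r1, A)" "Y \<in> hom C (Dom C Y) B" "A \<in> hom C (Dom C A) B"
    "r1 \<in> hom C (Dom C Y) (Dom C A)" "A \<cdot> r1 = Y" using r by (rule slice_hom_cases)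
  obtain s1 where s1: "s = (Y, s1, A')" "s1 \<in> hom C (Dom C Y) (Dom C A')"
    using s by (rule slice_hom_cases)
  obtain t1 where t1: "t = (Y, t1, D)" "t1 \<in> hom C (Dom C Y) (Dom C D)"
    using t by (rule slice_hom_cases)
  obtain a1 b1 a1' b1' where ab1: "a = (T, a1, Y)" "b = (T, b1, Y)" "a' = (T, a1', Y)" "b' = (T, b1', Y)"
    "a1 \<in> hom C (Dom C T) (Dom C Y)" "b1 \<in> hom C (Dom C T) (Dom C Y)"
    "a1' \<in> hom C (Dom C T) (Dom C Y)" "b1' \<in> hom C (Dom C T) (Dom C Y)"
    using ab unfolding slice_hom_iff by blast
  have "t1 \<cdot> b1 = t1 \<cdot> b1'"
  proof (rule kernel_shift[OF r1(4) s1(2) t1(2) _ ab1(5,6,7,8)])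
    fix S c d assume c: "c \<in> hom C S (Dom C Y)" and d: "d \<in> hom C S (Dom C Y)"
      and rcd: "r1 \<cdot> c = r1 \<cdot> d" and scd: "s1 \<cdot> c = s1 \<cdot> d"
    have Yc: "Y \<cdot> c \<in> hom C S B" using comp_in_hom c r1(2) by blast
    \<comment> \<open>Since \<open>r\<close> lies over \<open>B\<close>, the structure map
      \<open>Y\<close> factors through \<open>r1\<close>. So \<open>c\<close> and \<open>d\<close>
      become arrows of the slice with a common source.\<close>
    have "Y \<cdot> c = Y \<cdot> d"
      using comp_assoc[OF c r1(4,3)] comp_assoc[OF d r1(4,3)] r1(5) rcd by simp
    then have "(Y \<cdot> c, c, Y) \<in> hom (slice C B) (Y \<cdot> c) Y" "(Y \<cdot> c, d, Y) \<in> hom (slice C B) (Y \<cdot> c) Y"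
      using Yc c d r1(2) hom_ArD(2)[OF Yc] by (auto simp: slice_hom_iff)
    then show "t1 \<cdot> c = t1 \<cdot> d" using le rcd scd unfolding r1(1) s1(1) t1(1) by fastforce
  qed (use eqs in \<open>simp_all add: r1(1) s1(1) t1(1) ab1(1-4)\<close>)
  then show "t \<cdot>\<^bsub>slice C B\<^esub> b = t \<cdot>\<^bsub>slice C B\<^esub> b'" by (simp add: t1(1) ab1)
qed

section \<open>Monoids of endomorphisms\<close>

locale endomorphisms = ambient_category C
  for C :: "('o, 'a) cat" (structure) +
  fixes G u v j k
  assumes internal: "internal_category C G"
    and endo: "endomorphism_object C G u v j k"
begin

abbreviation E where "E \<equiv> Dom C j"

lemma X0_Ob: "X0 G \<in> Ob C"
  and d0_in_hom: "d0 G \<in> hom C (X1 G) (X0 G)"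
  and d1_in_hom: "d1 G \<in> hom C (X1 G) (X0 G)"
  and s0_in_hom: "s0 G \<in> hom C (X0 G) (X1 G)"
  and d0_s0: "d0 G \<cdot> s0 G = Idn C (X0 G)"
  and d1_s0: "d1 G \<cdot> s0 G = Idn C (X0 G)"
  and composable: "is_pullback C (d0 G) (d1 G) (pr1 G) (pr2 G)"
  and cmp_in_hom: "cmp G \<in> hom C (Dom C (pr1 G)) (X1 G)"
  and d0_cmp: "d0 G \<cdot> cmp G = d0 G \<cdot> pr2 G"
  and d1_cmp: "d1 G \<cdot> cmp G = d1 G \<cdot> pr1 G"
  using internal by (simp_all add: internal_category_def)

section \<open>Composition of generalized arrows of the internal category\<close>

lemma icomp_unit:
  assumes "x \<in> hom C T (X1 G)"
  shows "icomp C G x (s0 G \<cdot> (d0 G \<cdot> x)) = x" "icomp C G (s0 G \<cdot> (d1 G \<cdot> x)) x = x"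
  using internal assms hom_Ob[OF assms] by (simp_all add: internal_category_def)

lemma icomp_assoc:
  assumes "x \<in> hom C T (X1 G)" "y \<in> hom C T (X1 G)" "z \<in> hom C T (X1 G)"
    "d0 G \<cdot> x = d1 G \<cdot> y" "d0 G \<cdot> y = d1 G \<cdot> z"
  shows "icomp C G (icomp C G x y) z = icomp C G x (icomp C G y z)"
  using internal assms hom_Ob[OF assms(1)] by (simp add: internal_category_def)

lemmas composable_projections = pullback_projections[OF composable d0_in_hom d1_in_hom]
  and composable_pair = pullback_pair_props[OF composable d0_in_hom d1_in_hom]

lemma icomp_props:
  assumes "x \<in> hom C T (X1 G)" "y \<in> hom C T (X1 G)" "d0 G \<cdot> x = d1 G \<cdot> y"
  shows "icomp C G x y \<in> hom C T (X1 G)" "d0 G \<cdot> icomp C G x y = d0 G \<cdot> y"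
    "d1 G \<cdot> icomp C G x y = d1 G \<cdot> x"
proof -
  let ?c = "pair C (pr1 G) (pr2 G) x y"
  have c: "?c \<in> hom C T (Dom C (pr1 G))" and c1: "pr1 G \<cdot> ?c = x" and c2: "pr2 G \<cdot> ?c = y"
    using composable_pair[OF assms] by blast+
  show "icomp C G x y \<in> hom C T (X1 G)"
    unfolding icomp_def using c cmp_in_hom comp_in_hom by blast
  show "d0 G \<cdot> icomp C G x y = d0 G \<cdot> y"
    unfolding icomp_def using comp_assoc[OF c cmp_in_hom d0_in_hom]
      comp_assoc[OF c composable_projections(2) d0_in_hom] d0_cmp c2 by simp
  show "d1 G \<cdot> icomp C G x y = d1 G \<cdot> x"
    unfolding icomp_def using comp_assoc[OF c cmp_in_hom d1_in_hom]
      comp_assoc[OF c composable_projections(1) d1_in_hom] d1_cmp c1 by simp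
qed

lemma icomp_comp:
  assumes "x \<in> hom C T (X1 G)" "y \<in> hom C T (X1 G)" "d0 G \<cdot> x = d1 G \<cdot> y" "h \<in> hom C S T"
  shows "icomp C G x y \<cdot> h = icomp C G (x \<cdot> h) (y \<cdot> h)"
  unfolding icomp_def
  using comp_assoc[OF assms(4) conjunct1[OF composable_pair[OF assms(1-3)]] cmp_in_hom]
    pullback_pair_comp[OF composable d0_in_hom d1_in_hom assms] by simp

section \<open>Endomorphisms as generalized elements of \<open>E\<close>\<close>

lemma X0_square: "is_product C (X0 G) (X0 G) u v"
  and endo_pullback:
    "is_pullback C (pair C u v (d0 G) (d1 G)) (pair C u v (Idn C (X0 G)) (Idn C (X0 G))) j k"
  using endo by (simp_all add: endomorphism_object_def)

lemmas d_pair = pair_props[OF X0_square d0_in_hom d1_in_hom]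
  and diagonal = pair_props[OF X0_square Idn_in_hom[OF X0_Ob] Idn_in_hom[OF X0_Ob]]

lemma j_in_hom: "j \<in> hom C E (X1 G)"
  and k_in_hom: "k \<in> hom C E (X0 G)"
  and square_commutes:
    "pair C u v (d0 G) (d1 G) \<cdot> j = pair C u v (Idn C (X0 G)) (Idn C (X0 G)) \<cdot> k"
  using pullback_projections[OF endo_pullback conjunct1[OF d_pair] conjunct1[OF diagonal]] by blast+

lemma Dom_k: "Dom C k = E"
  using hom_ArD(2)[OF k_in_hom] .

text \<open>The commuting pullback square, compared coordinate by coordinate in the square of
  \<open>X0 G\<close>.\<close>

lemma d_j: "d0 G \<cdot> j = k" "d1 G \<cdot> j = k"
proof -
  have "pair C u v (d0 G \<cdot> j) (d1 G \<cdot> j) = pair C u v k k"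
    using square_commutes pair_comp[OF X0_square d0_in_hom d1_in_hom j_in_hom]
      pair_comp[OF X0_square Idn_in_hom[OF X0_Ob] Idn_in_hom[OF X0_Ob] k_in_hom]
    by (simp add: Idn_comp[OF k_in_hom])
  then show "d0 G \<cdot> j = k" "d1 G \<cdot> j = k"
    using pair_props[OF X0_square comp_in_hom[OF j_in_hom d0_in_hom] comp_in_hom[OF j_in_hom d1_in_hom]]
      pair_props[OF X0_square k_in_hom k_in_hom] by metis+
qed

lemma d_j_comp:
  assumes "x \<in> hom C T E"
  shows "d0 G \<cdot> (j \<cdot> x) = k \<cdot> x" "d1 G \<cdot> (j \<cdot> x) = k \<cdot> x"
  using comp_assoc[OF assms j_in_hom d0_in_hom] comp_assoc[OF assms j_in_hom d1_in_hom] d_j by simp_all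

lemma endo_compatible:
  assumes "x \<in> hom C T (X1 G)" "t \<in> hom C T (X0 G)" "d0 G \<cdot> x = t" "d1 G \<cdot> x = t"
  shows "pair C u v (d0 G) (d1 G) \<cdot> x = pair C u v (Idn C (X0 G)) (Idn C (X0 G)) \<cdot> t"
  using pair_comp[OF X0_square d0_in_hom d1_in_hom assms(1)] assms(3,4)
    pair_comp[OF X0_square Idn_in_hom[OF X0_Ob] Idn_in_hom[OF X0_Ob] assms(2)]
  by (simp add: Idn_comp[OF assms(2)])

text \<open>Together with \<open>d_j_comp\<close> and \<open>endo_pair_eq\<close> this identifies
  the elements of \<open>E\<close> over \<open>t\<close> with the generalized arrows from
  \<open>t\<close> to itself.\<close>

lemma endo_pair_props:
  assumes "x \<in> hom C T (X1 G)" "t \<in> hom C T (X0 G)" "d0 G \<cdot> x = t" "d1 G \<cdot> x = t"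
  shows "pair C j k x t \<in> hom C T E" "j \<cdot> pair C j k x t = x" "k \<cdot> pair C j k x t = t"
  using pullback_pair_props[OF endo_pullback conjunct1[OF d_pair] conjunct1[OF diagonal]
      assms(1,2) endo_compatible[OF assms]] by blast+

lemma endo_pair_comp:
  assumes "x \<in> hom C T (X1 G)" "t \<in> hom C T (X0 G)" "d0 G \<cdot> x = t" "d1 G \<cdot> x = t" "h \<in> hom C S T"
  shows "pair C j k x t \<cdot> h = pair C j k (x \<cdot> h) (t \<cdot> h)"
  using pullback_pair_comp[OF endo_pullback conjunct1[OF d_pair] conjunct1[OF diagonal]
      assms(1,2) endo_compatible[OF assms(1-4)] assms(5)] .

lemma endo_pair_eq:
  assumes "h \<in> hom C T E" "j \<cdot> h = x" "k \<cdot> h = t"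
  shows "pair C j k x t = h"
proof -
  have "x \<in> hom C T (X1 G)" "t \<in> hom C T (X0 G)" "d0 G \<cdot> x = t" "d1 G \<cdot> x = t"
    using assms comp_in_hom j_in_hom k_in_hom d_j_comp by blast+
  from endo_pair_props[OF this] show ?thesis
    by (intro pullback_eqI[OF endo_pullback _ assms(1)]) (simp_all add: assms(2,3))
qed

lemma endo_icomp_props:
  assumes "x \<in> hom C T E" "y \<in> hom C T E" "k \<cdot> x = t" "k \<cdot> y = t"
  shows "icomp C G (j \<cdot> x) (j \<cdot> y) \<in> hom C T (X1 G)"
    "t \<in> hom C T (X0 G)"
    "d0 G \<cdot> icomp C G (j \<cdot> x) (j \<cdot> y) = t" "d1 G \<cdot> icomp C G (j \<cdot> x) (j \<cdot> y) = t"
  using icomp_props[OF comp_in_hom[OF assms(1) j_in_hom] comp_in_hom[OF assms(2) j_in_hom]]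
    d_j_comp[OF assms(1)] d_j_comp[OF assms(2)] assms(3,4) comp_in_hom[OF assms(1) k_in_hom] by simp_all

abbreviation S where "S \<equiv> slice C (X0 G)"

end

sublocale endomorphisms \<subseteq> S: ambient_category S
  by unfold_locales (rule slice_category)

locale endomorphisms_square = endomorphisms +
  fixes P Q
  assumes endo_square: "is_product S k k P Q"
begin

abbreviation M where "M \<equiv> endo_mult C G j k P Q"

text \<open>At stage \<open>t\<close> of the slice, an element of \<open>k\<close> amounts to an
  endomorphism of the generalized object \<open>t\<close>.\<close>

lemma S_element:
  assumes "x \<in> hom S t k"
  obtains x' where "x = (t, x', k)" "x' \<in> hom C (Dom C t) E" "k \<cdot> x' = t"
    "t \<in> hom C (Dom C t) (X0 G)"
  using slice_hom_cases[OF assms] Dom_k by metis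

lemma S_elementI:
  assumes "x' \<in> hom C T E" "k \<cdot> x' = t"
  shows "(t, x', k) \<in> hom S t k"
proof -
  have "t \<in> hom C T (X0 G)" using assms comp_in_hom k_in_hom by blast
  then show ?thesis
    using assms k_in_hom hom_ArD(2)[of t T] by (auto simp: slice_hom_iff Dom_k)
qed

lemma M_in_hom: "M \<in> hom S (Dom S P) k"
  and mul_endo:
    "\<lbrakk>(t, x, k) \<in> hom S t k; (t, y, k) \<in> hom S t k\<rbrakk> \<Longrightarrow>
      mul S P Q M (t, x, k) (t, y, k) = (t, pair C j k (icomp C G (j \<cdot> x) (j \<cdot> y)) t, k)"
proof -
  \<comment> \<open>The apex of a product in the slice is itself an arrow to \<open>X0 G\<close>; as
    an object of \<open>C\<close> the product is \<open>Dom C w\<close>.\<close>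
  define w where "w = Dom S P"
  obtain P' where P: "P = (w, P', k)" "P' \<in> hom C (Dom C w) E" "k \<cdot> P' = w"
    using S.product_projections(1)[OF endo_square] unfolding w_def by (rule S_element)
  obtain Q' where Q: "Q = (w, Q', k)" "Q' \<in> hom C (Dom C w) E" "k \<cdot> Q' = w"
    using S.product_projections(2)[OF endo_square] unfolding w_def by (rule S_element)
  define n where "n = pair C j k (icomp C G (j \<cdot> P') (j \<cdot> Q')) w"
  have M: "M = (w, n, k)"
    by (simp add: endo_mult_def w_def[symmetric] n_def P(1) Q(1) underlying_def)
      (simp add: slice_def)
  note PQ = endo_icomp_props[OF P(2) Q(2) P(3) Q(3)]
  note n = endo_pair_props[OF PQ, folded n_def]
  have "M \<in> hom S w k" unfolding M by (rule S_elementI[OF n(1,3)])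
  then show "M \<in> hom S (Dom S P) k" by (simp add: w_def)
  assume xy: "(t, x, k) \<in> hom S t k" "(t, y, k) \<in> hom S t k"
  note props = S.pair_props[OF endo_square xy, folded w_def]
  then obtain h where h: "pair S P Q (t, x, k) (t, y, k) = (t, h, w)"
    "h \<in> hom C (Dom C t) (Dom C w)" "w \<cdot> h = t"
    using slice_hom_cases[OF conjunct1] by metis
  have Ph: "P' \<cdot> h = x" and Qh: "Q' \<cdot> h = y"
    using props unfolding h(1) unfolding P(1) Q(1) by simp_all
  have jP: "j \<cdot> P' \<in> hom C (Dom C w) (X1 G)" and jQ: "j \<cdot> Q' \<in> hom C (Dom C w) (X1 G)"
    using comp_in_hom P(2) Q(2) j_in_hom by blast+
  have "d0 G \<cdot> (j \<cdot> P') = d1 G \<cdot> (j \<cdot> Q')"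
    using d_j_comp[OF P(2)] d_j_comp[OF Q(2)] P(3) Q(3) by simp
  \<comment> \<open>Here \<open>n\<close> is the composite of the generic pair of endomorphisms.
    Composition and factorization through \<open>E\<close> are natural, so precomposing with
    \<open>h\<close> evaluates it at \<open>x\<close> and \<open>y\<close>.\<close>
  from icomp_comp[OF jP jQ this h(2)]
  have "n \<cdot> h = pair C j k (icomp C G (j \<cdot> x) (j \<cdot> y)) t"
    unfolding n_def endo_pair_comp[OF PQ h(2)]
    by (simp add: h(3) comp_assoc[OF h(2) P(2) j_in_hom] comp_assoc[OF h(2) Q(2) j_in_hom] Ph Qh)
  then show "mul S P Q M (t, x, k) (t, y, k) = (t, pair C j k (icomp C G (j \<cdot> x) (j \<cdot> y)) t, k)"
    unfolding mul_def h(1) M by simp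
qed

text \<open>The unit laws are those of the internal category, once the unit at stage
  \<open>t\<close> is recognized as the identity arrow \<open>s0 G\<close> at
  \<open>t\<close>.\<close>

lemma endo_unitary_magma: "unitary_magma S (Idn C (X0 G)) k (endo_unit C G j k) P Q M"
proof -
  let ?I = "Idn C (X0 G)"
  note I = Idn_in_hom[OF X0_Ob]
  note unit = endo_pair_props[OF s0_in_hom I d0_s0 d1_s0]
  have e: "endo_unit C G j k \<in> hom S ?I k"
    unfolding endo_unit_def by (rule S_elementI[OF unit(1,3)])
  note terminal = slice_terminal[OF X0_Ob]
  have "mul S P Q M (endo_unit C G j k \<cdot>\<^bsub>S\<^esub> bang S ?I t) x = x \<and>
      mul S P Q M x (endo_unit C G j k \<cdot>\<^bsub>S\<^esub> bang S ?I t) = x" if x: "x \<in> hom S t k" for t x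
  proof -
    obtain x' where x': "x = (t, x', k)" "x' \<in> hom C (Dom C t) E" "k \<cdot> x' = t"
      "t \<in> hom C (Dom C t) (X0 G)" using x by (rule S_element)
    have "(t, t, ?I) \<in> hom S t ?I"
      using x'(4) I hom_ArD(2)[OF I] Idn_comp[OF x'(4)] by (simp add: slice_hom_iff)
    \<comment> \<open>The terminal arrow from \<open>t\<close> has \<open>t\<close> as underlying
      arrow, so the unit at stage \<open>t\<close> is the global unit precomposed with
      \<open>t\<close>.\<close>
    then have bang: "bang S ?I t = (t, t, ?I)"
      using S.terminal_unique[OF terminal] S.bang_in_hom[OF terminal] S.hom_Ob(1)[OF x] by blast
    define n where "n = pair C j k (s0 G) ?I \<cdot> t"
    have n: "n \<in> hom C (Dom C t) E" "j \<cdot> n = s0 G \<cdot> t" "k \<cdot> n = t"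
      unfolding n_def using comp_in_hom[OF x'(4) unit(1)] comp_assoc[OF x'(4) unit(1) j_in_hom]
        comp_assoc[OF x'(4) unit(1) k_in_hom] unit(2,3) Idn_comp[OF x'(4)] by simp_all
    have u: "endo_unit C G j k \<cdot>\<^bsub>S\<^esub> bang S ?I t = (t, n, k)"
      unfolding bang by (simp add: endo_unit_def n_def)
    have n_hom: "(t, n, k) \<in> hom S t k" by (rule S_elementI[OF n(1,3)])
    note x_hom = x[unfolded x'(1)]
    show ?thesis
      unfolding u x'(1) mul_endo[OF n_hom x_hom] mul_endo[OF x_hom n_hom] n(2)
      using icomp_unit[OF comp_in_hom[OF x'(2) j_in_hom]] d_j_comp[OF x'(2)] x'(3)
        endo_pair_eq[OF x'(2) refl x'(3)] by simp
  qed
  moreover have "k \<in> Ob S" using k_in_hom by (simp add: slice_def hom_def)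
  ultimately show ?thesis
    unfolding unitary_magma_def pointed_object_def using terminal e endo_square M_in_hom by blast
qed

text \<open>Read off from associativity in the internal category; going through
  \<open>mult_assoc\<close> would call for finite completeness of the slice.\<close>

lemma endo_associative: "magma_associative S k P Q M"
  unfolding magma_associative_def
proof (intro ballI)
  fix t x y z assume xyz: "x \<in> hom S t k" "y \<in> hom S t k" "z \<in> hom S t k"
  obtain x' where x: "x = (t, x', k)" "x' \<in> hom C (Dom C t) E" "k \<cdot> x' = t"
    using xyz(1) by (rule S_element)
  obtain y' where y: "y = (t, y', k)" "y' \<in> hom C (Dom C t) E" "k \<cdot> y' = t"
    using xyz(2) by (rule S_element)
  obtain z' where z: "z = (t, z', k)" "z' \<in> hom C (Dom C t) E" "k \<cdot> z' = t"
    using xyz(3) by (rule S_element)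
  note xy = endo_pair_props[OF endo_icomp_props[OF x(2) y(2) x(3) y(3)]]
    and yz = endo_pair_props[OF endo_icomp_props[OF y(2) z(2) y(3) z(3)]]
  note homs = xyz[unfolded x(1) y(1) z(1)]
  have "icomp C G (icomp C G (j \<cdot> x') (j \<cdot> y')) (j \<cdot> z') = icomp C G (j \<cdot> x') (icomp C G (j \<cdot> y') (j \<cdot> z'))"
    using icomp_assoc[OF comp_in_hom[OF x(2) j_in_hom] comp_in_hom[OF y(2) j_in_hom]
        comp_in_hom[OF z(2) j_in_hom]]
      d_j_comp[OF x(2)] d_j_comp[OF y(2)] d_j_comp[OF z(2)] x(3) y(3) z(3) by simp
  then show "mul S P Q M (mul S P Q M x y) z = mul S P Q M x (mul S P Q M y z)"
    unfolding x(1) y(1) z(1) mul_endo[OF homs(1,2)] mul_endo[OF homs(2,3)]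
      mul_endo[OF S_elementI[OF xy(1,3)] homs(3)] mul_endo[OF homs(1) S_elementI[OF yz(1,3)]]
      xy(2) yz(2) by simp
qed

end

text \<open>The first two claims are the magma results in \<open>C\<close>; the third applies the
  same results to the magma of endomorphisms in the slice over \<open>X0 G\<close>.\<close>

theorem proposition4p8:
  fixes C :: "('o, 'a) cat"
  assumes "gumm_category C"
  shows
    "(\<forall>I X e p q. pointed_object C I X e \<and> is_product C X X p q \<longrightarrow>
        (\<exists>\<^sub>\<le>\<^sub>1 m. unitary_magma C I X e p q m) \<and>
        (\<forall>m. unitary_magma C I X e p q m \<longrightarrow>
           magma_associative C X p q m \<and> left_cancellable C X p q m \<and>
           magma_commutative C X p q m)) \<and>
     (\<forall>I X e p q m X' e' p' q' m' f.
        unitary_magma C I X e p q m \<and> unitary_magma C I X' e' p' q' m' \<and>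
        pointed_morphism C X e X' e' f \<longrightarrow>
        monoid_hom C I X e p q m X' e' p' q' m' f) \<and>
     (\<forall>G u v j k P Q.
        internal_category C G \<and> endomorphism_object C G u v j k \<and>
        is_product (slice C (X0 G)) k k P Q \<longrightarrow>
        internal_monoid (slice C (X0 G)) (Idn C (X0 G)) k
          (endo_unit C G j k) P Q (endo_mult C G j k P Q) \<and>
        left_cancellable (slice C (X0 G)) k P Q (endo_mult C G j k P Q) \<and>
        magma_commutative (slice C (X0 G)) k P Q (endo_mult C G j k P Q))"
proof -
  have fc: "finitely_complete C" using assms by (simp add: gumm_category_def)
  interpret kernel_shifting_category C
    using fc gumm_category_kernel_shifting[OF assms]
    by unfold_locales (simp_all add: finitely_complete_def)
  have magma: "magma_in_category C I X e p q m" if "unitary_magma C I X e p q m" for I X e p q m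
    using that by unfold_locales
  show ?thesis
  proof (intro conjI allI impI; elim conjE)
    fix I X e p q
    show "\<exists>\<^sub>\<le>\<^sub>1 m. unitary_magma C I X e p q m"
      using magma_in_category.unitary_magma_unique[OF magma] by (auto intro!: Uniq_I)
  next
    fix I X e p q m assume m: "unitary_magma C I X e p q m"
    show "magma_associative C X p q m"
      using magma_in_category.magma_associative[OF magma[OF m] fc] .
    show "left_cancellable C X p q m"
      using magma_in_category.magma_left_cancellable[OF magma[OF m]] .
    show "magma_commutative C X p q m"
      using magma_in_category.magma_commutative[OF magma[OF m]] .
  next
    fix I X e p q m X' e' p' q' m' f
    assume m: "unitary_magma C I X e p q m" and m': "unitary_magma C I X' e' p' q' m'"
      and f: "pointed_morphism C X e X' e' f"
    interpret magma_in_category C I X e p q m using magma[OF m] .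
    show "monoid_hom C I X e p q m X' e' p' q' m' f"
      unfolding monoid_hom_def internal_monoid_def
      \<comment> \<open>Compatibility at the generic pair of projections is the required equation
        between arrows.\<close>
      using m m' f magma_associative[OF fc] magma_in_category.magma_associative[OF magma[OF m'] fc]
        pointed_morphism_mult[OF m' f p_in_hom q_in_hom] mult_projections
      by (simp add: mul_def)
  next
    fix G u v j k P Q
    assume GE: "internal_category C G" "endomorphism_object C G u v j k"
      "is_product (slice C (X0 G)) k k P Q"
    interpret endomorphisms_square C G u v j k P Q
      by unfold_locales (rule GE)+
    interpret endo: magma_in_category S "Idn C (X0 G)" k "endo_unit C G j k" P Q M
      by unfold_locales (rule slice_kernel_shifting endo_unitary_magma)+
    show "internal_monoid S (Idn C (X0 G)) k (endo_unit C G j k) P Q M"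
      unfolding internal_monoid_def using endo_unitary_magma endo_associative ..
    show "left_cancellable S k P Q M" by (rule endo.magma_left_cancellable)
    show "magma_commutative S k P Q M" by (rule endo.magma_commutative)
  qed
qed

end
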